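(* Let $d,m\in\mathbb{N}$, let $p_1,\ldots,p_m\in\mathbb{R}[x]\setminus\{0\}$ and let $A:=(p_1,\ldots,p_m)_{\ge 0}$. Let $f\in\mathbb{R}[x]$ be a polynomial irreducible over $\mathbb{R}[x]$. Assume that there exist $b\in Z(f)$ and $\varepsilon>0$ such that $$\dim(Z(f)\cap B^d(b,\varepsilon)) = d-1,\qquad Z(f)\cap B^d(b,\varepsilon)=A\cap B^d(b,\varepsilon),$$ and additionally $$\dim(\operatorname{int} A\cap Z(f)) = d-1.$$ Then $f$ is a factor of $p_i$ for some $i\in\{1,\ldots,m\}$ and, for every $i\in\{1,\ldots,m\}$ such that $p_i$ is divisible by $f$, the factor $f$ of $p_i$ has even multiplicity.
   Context: $\mathbb{R}[x]=\mathbb{R}[x_1,\ldots,x_d]$ is the ring of real polynomials in $d$ variables. $(p_1,\ldots,p_m)_{\ge 0}=\{x\in\mathbb{R}^d: p_1(x)\ge 0,\ldots,p_m(x)\ge 0\}$ and $Z(f)=\{x\in\mathbb{R}^d: f(x)=0\}$. $B^d(c,\rho)$ is the open Euclidean ball in $\mathbb{R}^d$ with center $c$ and radius $\rho$; $\operatorname{int}$ denotes the topological interior in $\mathbb{R}^d$. The dimension $\dim S$ of a semi-algebraic set $S\subseteq\mathbb{R}^d$ is the Krull dimension of the ring $\mathbb{R}[x]/\mathcal{I}(S)$, where $\mathcal{I}(S)=\{p\in\mathbb{R}[x]: p(x)=0 \text{ for all } x\in S\}$ (the usual semi-algebraic dimension, with the zero ring, i.e. $S=\emptyset$, having negative dimension).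 A polynomial is irreducible over $\mathbb{R}[x]$ if it is non-constant and is not a product of two non-constant polynomials in $\mathbb{R}[x]$. $p$ is a factor of $q$ if $q=pg$ for some $g\in\mathbb{R}[x]$. An irreducible factor $f$ of $p$ has multiplicity $k\in\mathbb{N}$ ($k\ge1$) if $f^k$ is a factor of $p$ but $f^{k+1}$ is not. *)

theory Defs
  imports
    "HOL-Algebra.Algebraic_Closure_Type"
    "HOL-Library.Poly_Mapping"
    "HOL-Analysis.Analysis"
    "HOL-Computational_Algebra.Factorial_Ring"
begin

hide_const (open) Divisibility.irreducible

text \<open>
  Hence \<^term>\<open>irreducible\<close> is the type-class notion (nonzero, not a unit, and one factor of any
  factorisation is a unit). The units of a polynomial ring over a field are the nonzero
  constants.
\<close>

text \<open>
  A polynomial over the reals in the variables indexed by \<^typ>\<open>'n\<close> is a finitely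
  supported map from exponent vectors to coefficients; multiplication is the convolution
  product of \<^type>\<open>poly_mapping\<close>.
\<close>

type_synonym 'n rpoly = "('n \<Rightarrow>\<^sub>0 nat) \<Rightarrow>\<^sub>0 real"

definition rpoly_eval :: "('n::finite) rpoly \<Rightarrow> real ^ 'n \<Rightarrow> real" where
  "rpoly_eval p x =
     (\<Sum>m\<in>Poly_Mapping.keys p. Poly_Mapping.lookup p m *
        (\<Prod>i\<in>UNIV. (x $ i) ^ Poly_Mapping.lookup m i))"

definition zero_set :: "('n::finite) rpoly \<Rightarrow> (real ^ 'n) set" where
  "zero_set f = {x. rpoly_eval f x = 0}"

definition nonneg_set :: "nat \<Rightarrow> (nat \<Rightarrow> ('n::finite) rpoly) \<Rightarrow> (real ^ 'n) set" where
  "nonneg_set m p = {x. \<forall>i\<in>{1..m}. 0 \<le> rpoly_eval (p i) x}"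

definition vanishing_ideal :: "(real ^ 'n) set \<Rightarrow> ('n::finite) rpoly set" where
  "vanishing_ideal S = {p. \<forall>x\<in>S. rpoly_eval p x = 0}"

text \<open>
  The supremum of the lengths \<open>n\<close> of chains \<open>P 0 \<subset> \<dots> \<subset> P n\<close> of prime ideals.
  It is taken in \<^typ>\<open>ereal\<close>, so that the zero ring, which has no prime ideals, gets
  dimension \<^term>\<open>-\<infinity> :: ereal\<close>.
\<close>

definition krull_dim :: "('a, 'b) ring_scheme \<Rightarrow> ereal" where
  "krull_dim R = Sup {ereal (real n) | n. \<exists>P :: nat \<Rightarrow> 'a set.
     (\<forall>i\<le>n. primeideal (P i) R) \<and> (\<forall>i<n. P i \<subset> P (Suc i))}"

definition semialg_dim :: "(real ^ 'n) set \<Rightarrow> ereal" where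
  "semialg_dim S =
     krull_dim ((ring_of_type_algebra :: ('n::finite) rpoly ring) Quot vanishing_ideal S)"

definition has_multiplicity :: "('n::finite) rpoly \<Rightarrow> nat \<Rightarrow> 'n rpoly \<Rightarrow> bool" where
  "has_multiplicity f k p \<longleftrightarrow> 1 \<le> k \<and> f ^ k dvd p \<and> \<not> f ^ (k + 1) dvd p"

end

theory Submission
  imports Defs
begin

text \<open>
  Write \<open>d\<close> for the number of variables and let \<open>S\<close> be a subset of \<open>Z(f)\<close> of dimension \<open>d - 1\<close>. The key is that
  every polynomial vanishing on \<open>S\<close> is a multiple of \<open>f\<close>. Indeed, the vanishing ideal of \<open>S\<close> has a chain of \<open>d\<close>
  primes above it. If it contained more than the multiples of \<open>f\<close>, this chain could be prolonged by the primes
  \<open>(f)\<close> and \<open>(0)\<close>, and the polynomial ring would have dimension greater than \<open>d\<close>. Two facts of commutative algebra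
  enter here: polynomials in several variables factor uniquely, so that \<open>(f)\<close> is prime
  (\<open>irreducible_dvd_mult\<close>), and the polynomial ring has dimension at most \<open>d\<close> (\<open>prime_chain_length\<close>).

  Some partial derivative of \<open>f\<close> is not a multiple of \<open>f\<close>. If \<open>g\<close> is not one either, primality of \<open>f\<close>
  gives a point of \<open>S\<close> at which neither \<open>g\<close> nor this derivative vanishes; near that point \<open>f\<close>
  takes both signs (\<open>sign_change_point\<close>).

  This is applied twice. If \<open>f\<close> divided no \<open>p\<^sub>i\<close>, take \<open>S = Z(f) \<inter> B\<close> for the given ball \<open>B\<close>, and \<open>g\<close> the product of the
  \<open>p\<^sub>i\<close>: at the point obtained all \<open>p\<^sub>i\<close> are positive, so a neighbourhood of it lies in \<open>A \<inter> B\<close> and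
  therefore in \<open>Z(f)\<close>, although \<open>f\<close> is not zero on it. If \<open>p\<^sub>i = f\<^sup>k q\<close> with \<open>k\<close> odd and \<open>q\<close> not divisible by
  \<open>f\<close>, take \<open>S = int A \<inter> Z(f)\<close> and \<open>g = q\<close>: then \<open>p\<^sub>i\<close> changes sign inside \<open>A\<close>, where it is nonnegative.

  Unique factorization is obtained by adjoining the variables one at a time, with a version of Gauss's lemma that
  works by pseudo-division. The dimension bound holds because elements chosen along a
  chain of primes are algebraically independent, while \<open>d + 1\<close> polynomials in \<open>d\<close> variables never are.
\<close>

section \<open>Unique factorization passes to polynomial rings\<close>

text \<open>
  A unique factorization domain, presented in a form that carries over to its polynomial ring.
  It is a subset of a type, because the number of variables is going to grow one by one inside
  a single type. The additive norm \<open>N\<close> plays the part of the number of prime factors: the elements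
  of norm zero are the units, and the existence of factorizations into irreducibles follows by
  induction on it. Uniqueness is the requirement that irreducible elements are prime.
\<close>

locale factorial_subring =
  fixes R :: "'a::comm_ring_1 set" and N :: "'a \<Rightarrow> nat"
  assumes zero_closed: "0 \<in> R" and one_closed: "1 \<in> R"
    and add_closed: "a \<in> R \<Longrightarrow> b \<in> R \<Longrightarrow> a + b \<in> R"
    and uminus_closed: "a \<in> R \<Longrightarrow> - a \<in> R"
    and mult_closed: "a \<in> R \<Longrightarrow> b \<in> R \<Longrightarrow> a * b \<in> R"
    and no_zero_div: "a \<in> R \<Longrightarrow> b \<in> R \<Longrightarrow> a * b = 0 \<Longrightarrow> a = 0 \<or> b = 0"
    and norm_mult: "a \<in> R \<Longrightarrow> b \<in> R \<Longrightarrow> a \<noteq> 0 \<Longrightarrow> b \<noteq> 0 \<Longrightarrow> N (a * b) = N a + N b"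
    and norm_0_unit: "a \<in> R \<Longrightarrow> a \<noteq> 0 \<Longrightarrow> N a = 0 \<Longrightarrow> \<exists>b\<in>R. a * b = 1"
    and irreducible_prime:
      "a \<in> R \<Longrightarrow> a \<noteq> 0 \<Longrightarrow> 0 < N a \<Longrightarrow>
       (\<And>b c. b \<in> R \<Longrightarrow> c \<in> R \<Longrightarrow> a = b * c \<Longrightarrow> N b = 0 \<or> N c = 0) \<Longrightarrow>
       b \<in> R \<Longrightarrow> c \<in> R \<Longrightarrow> d \<in> R \<Longrightarrow> b * c = a * d \<Longrightarrow>
       (\<exists>e\<in>R. b = a * e) \<or> (\<exists>e\<in>R. c = a * e)"
begin

lemma diff_closed: "a \<in> R \<Longrightarrow> b \<in> R \<Longrightarrow> a - b \<in> R"
  using add_closed[of a "- b"] uminus_closed by simp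

lemma sum_closed: "(\<And>i. i \<in> I \<Longrightarrow> g i \<in> R) \<Longrightarrow> sum g I \<in> R"
  by (induction I rule: infinite_finite_induct) (auto intro: zero_closed add_closed)

lemma norm_1: "N 1 = 0"
  using norm_mult[of 1 1] one_closed by simp

lemma exists_prime_divisor:
  assumes "a \<in> R" "a \<noteq> 0" "0 < N a"
  obtains q a' where "q \<in> R" "a' \<in> R" "a = q * a'" "0 < N q" "q \<noteq> 0"
    "\<And>b c d. b \<in> R \<Longrightarrow> c \<in> R \<Longrightarrow> d \<in> R \<Longrightarrow> b * c = q * d \<Longrightarrow>
       (\<exists>e\<in>R. b = q * e) \<or> (\<exists>e\<in>R. c = q * e)"
proof -
  have "\<exists>q a'. q \<in> R \<and> a' \<in> R \<and> a = q * a' \<and> 0 < N q \<and> q \<noteq> 0 \<and>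
    (\<forall>b c d. b \<in> R \<longrightarrow> c \<in> R \<longrightarrow> d \<in> R \<longrightarrow> b * c = q * d \<longrightarrow>
       (\<exists>e\<in>R. b = q * e) \<or> (\<exists>e\<in>R. c = q * e))"
    using assms
  proof (induction "N a" arbitrary: a rule: less_induct)
    case less
    show ?case
    proof (cases "\<forall>b c. b \<in> R \<longrightarrow> c \<in> R \<longrightarrow> a = b * c \<longrightarrow> N b = 0 \<or> N c = 0")
      case True
      then show ?thesis
        using irreducible_prime[of a] less.prems one_closed
        by (intro exI[of _ a] exI[of _ 1]) auto
    next
      case False
      then obtain b c where bc: "b \<in> R" "c \<in> R" "a = b * c" "0 < N b" "0 < N c" by auto
      have nz: "b \<noteq> 0" "c \<noteq> 0" using bc less.prems by auto
      have "N b < N a" using norm_mult[of b c] bc nz by simp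
      from less.hyps[OF this bc(1) nz(1) bc(4)] obtain q a' where
        q: "q \<in> R" "a' \<in> R" "b = q * a'" "0 < N q" "q \<noteq> 0"
        "\<forall>b c d. b \<in> R \<longrightarrow> c \<in> R \<longrightarrow> d \<in> R \<longrightarrow> b * c = q * d \<longrightarrow>
       (\<exists>e\<in>R. b = q * e) \<or> (\<exists>e\<in>R. c = q * e)" by blast
      have "a' * c \<in> R" "a = q * (a' * c)"
        using q bc mult_closed by (auto simp: ac_simps)
      then show ?thesis using q by blast
    qed
  qed
  then show ?thesis using that by blast
qed

definition polys :: "'a poly set" where
  "polys = {P. \<forall>i. coeff P i \<in> R}"

text \<open>
  The leading coefficient is multiplicative over a domain, so this is additive again. The total
  degree would also be additive in the case of interest, but additivity is harder to see for it.
\<close>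

definition poly_norm :: "'a poly \<Rightarrow> nat" where
  "poly_norm P = degree P + N (lead_coeff P)"

lemma polys_0: "0 \<in> polys" and polys_1: "1 \<in> polys"
  by (auto simp: polys_def zero_closed one_closed coeff_1)

lemma polys_const: "a \<in> R \<Longrightarrow> [:a:] \<in> polys"
  by (auto simp: polys_def zero_closed coeff_pCons split: nat.splits)

lemma polys_pCons: "pCons a P \<in> polys \<longleftrightarrow> a \<in> R \<and> P \<in> polys"
proof
  assume "pCons a P \<in> polys"
  then have h: "\<And>i. coeff (pCons a P) i \<in> R" by (auto simp: polys_def)
  show "a \<in> R \<and> P \<in> polys" using h[of 0] h[of "Suc _"] by (auto simp: polys_def)
qed (auto simp: polys_def coeff_pCons split: nat.splits)

lemma polys_add: "P \<in> polys \<Longrightarrow> Q \<in> polys \<Longrightarrow> P + Q \<in> polys"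
  by (auto simp: polys_def add_closed)

lemma polys_uminus: "P \<in> polys \<Longrightarrow> - P \<in> polys"
  by (auto simp: polys_def uminus_closed)

lemma polys_diff: "P \<in> polys \<Longrightarrow> Q \<in> polys \<Longrightarrow> P - Q \<in> polys"
  by (auto simp: polys_def diff_closed)

lemma polys_mult: "P \<in> polys \<Longrightarrow> Q \<in> polys \<Longrightarrow> P * Q \<in> polys"
  by (auto simp: polys_def coeff_mult intro!: sum_closed mult_closed)

lemma polys_monom: "a \<in> R \<Longrightarrow> monom a k \<in> polys"
  by (auto simp: polys_def zero_closed)

lemma polys_lead_coeff: "P \<in> polys \<Longrightarrow> lead_coeff P \<in> R"
  by (auto simp: polys_def)

lemmas polys_closed = polys_0 polys_1 polys_const polys_add polys_uminus polys_diff
  polys_mult polys_monom polys_lead_coeff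

lemma
  assumes "P \<in> polys" "Q \<in> polys" "P \<noteq> 0" "Q \<noteq> 0"
  shows polys_mult_nonzero: "P * Q \<noteq> 0"
    and polys_degree_mult: "degree (P * Q) = degree P + degree Q"
    and polys_lead_coeff_mult: "lead_coeff (P * Q) = lead_coeff P * lead_coeff Q"
proof -
  have c: "coeff (P * Q) (degree P + degree Q) = lead_coeff P * lead_coeff Q"
    by (rule coeff_mult_degree_sum)
  have "lead_coeff P * lead_coeff Q \<noteq> 0"
    using no_zero_div[of "lead_coeff P" "lead_coeff Q"] assms polys_lead_coeff by auto
  with c have nz: "coeff (P * Q) (degree P + degree Q) \<noteq> 0" by simp
  then show "P * Q \<noteq> 0" by auto
  show deg: "degree (P * Q) = degree P + degree Q"
    using nz le_degree degree_mult_le by (metis le_antisym)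
  show "lead_coeff (P * Q) = lead_coeff P * lead_coeff Q"
    using c deg by simp
qed

lemma poly_norm_mult:
  assumes "P \<in> polys" "Q \<in> polys" "P \<noteq> 0" "Q \<noteq> 0"
  shows "poly_norm (P * Q) = poly_norm P + poly_norm Q"
  using polys_degree_mult[OF assms] polys_lead_coeff_mult[OF assms] norm_mult
    assms polys_lead_coeff by (simp add: poly_norm_def)

lemma polys_cancel:
  assumes "P \<in> polys" "Q \<in> polys" "S \<in> polys" "P \<noteq> 0" "P * Q = P * S"
  shows "Q = S"
  using polys_mult_nonzero[of P "Q - S"] polys_diff[of Q S] assms by (auto simp: algebra_simps)

lemma poly_norm_0_unit:
  assumes "P \<in> polys" "P \<noteq> 0" "poly_norm P = 0"
  shows "\<exists>Q\<in>polys. P * Q = 1"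
proof -
  have "degree P = 0" using assms by (simp add: poly_norm_def)
  then obtain a where P: "P = [:a:]" by (rule degree_eq_zeroE)
  then have "a \<in> R" "a \<noteq> 0" "N a = 0"
    using assms polys_lead_coeff[of P] by (auto simp: poly_norm_def)
  then obtain b where "b \<in> R" "a * b = 1" using norm_0_unit by blast
  then show ?thesis using P polys_const by (intro bexI[of _ "[:b:]"]) (auto simp: one_pCons mult.commute)
qed

text \<open>
  Gauss's lemma: a prime of the coefficient ring stays prime in the polynomial ring. If it divides
  \<open>P * Q\<close>, it divides the product of the constant coefficients, hence one of them; that
  coefficient can be dropped and the induction goes on with a shorter polynomial.
\<close>

lemma const_prime:
  assumes q: "q \<in> R" "q \<noteq> 0"
    and prime: "\<And>b c d. b \<in> R \<Longrightarrow> c \<in> R \<Longrightarrow> d \<in> R \<Longrightarrow> b * c = q * d \<Longrightarrow>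
       (\<exists>e\<in>R. b = q * e) \<or> (\<exists>e\<in>R. c = q * e)"
    and "P \<in> polys" "Q \<in> polys" "S \<in> polys" "P * Q = [:q:] * S"
  shows "(\<exists>E\<in>polys. P = [:q:] * E) \<or> (\<exists>E\<in>polys. Q = [:q:] * E)"
  using assms(4-7)
proof (induction P arbitrary: Q S)
  case 0
  then show ?case using polys_0 by auto
next
  case (pCons a P)
  note outer_prems = pCons.prems and outer_IH = pCons.IH
  have a: "a \<in> R" and P: "P \<in> polys" using outer_prems polys_pCons by auto
  show ?case
  proof (cases "\<exists>e\<in>R. a = q * e")
    case True
    then obtain e where e: "e \<in> R" "a = q * e" by blast
    have eq: "pCons a P * Q = [:q:] * ([:e:] * Q) + pCons 0 (P * Q)"
      by (simp add: e(2) mult.commute)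
    then have "pCons 0 (P * Q) = [:q:] * (S - [:e:] * Q)"
      using outer_prems(4) by (simp add: algebra_simps)
    moreover obtain s T where ST: "S - [:e:] * Q = pCons s T" by (cases "S - [:e:] * Q")
    ultimately have PQ: "P * Q = [:q:] * T" by simp
    have "pCons s T \<in> polys"
      unfolding ST[symmetric] using outer_prems e by (intro polys_closed)
    then have "T \<in> polys" using polys_pCons by blast
    from outer_IH[OF P outer_prems(2) this PQ]
    show ?thesis
    proof
      assume "\<exists>E\<in>polys. P = [:q:] * E"
      then obtain E where "E \<in> polys" "P = [:q:] * E" by blast
      then have "pCons a P = [:q:] * pCons e E" "pCons e E \<in> polys"
        using e polys_pCons by auto
      then show ?thesis by blast
    qed auto
  next
    case False
    have "\<exists>E\<in>polys. Q = [:q:] * E" using outer_prems(2,3,4)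
    proof (induction Q arbitrary: S)
      case 0
      then show ?case using polys_0 by auto
    next
      case (pCons b Q)
      have b: "b \<in> R" and Q: "Q \<in> polys" using pCons.prems polys_pCons by auto
      have "a * b = q * coeff S 0"
        using arg_cong[OF pCons.prems(3), of "\<lambda>F. coeff F 0"] by (simp add: coeff_mult mult.commute)
      moreover have "coeff S 0 \<in> R" using pCons.prems by (auto simp: polys_def)
      ultimately obtain e where e: "e \<in> R" "b = q * e" using prime[OF a b] False by blast
      have "pCons 0 (pCons a P * Q) = [:q:] * (S - [:e:] * pCons a P)"
        using pCons.prems(3) e(2) by (simp add: algebra_simps)
      moreover obtain s T where ST: "S - [:e:] * pCons a P = pCons s T"
        by (cases "S - [:e:] * pCons a P")
      ultimately have PQ: "pCons a P * Q = [:q:] * T" by simp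
      have "pCons s T \<in> polys"
        unfolding ST[symmetric] using outer_prems(1) pCons.prems e by (intro polys_closed)
      then have "T \<in> polys" using polys_pCons by blast
      from pCons.IH[OF Q this PQ] obtain E where "E \<in> polys" "Q = [:q:] * E" by blast
      then have "pCons b Q = [:q:] * pCons e E" "pCons e E \<in> polys"
        using e polys_pCons by auto
      then show ?case by blast
    qed
    then show ?thesis ..
  qed
qed

text \<open>
  The prime factors of the constant \<open>c\<close> are distributed over the two factors one at a
  time. This is how constants introduced by clearing denominators are removed again, which avoids
  the fraction field.
\<close>

lemma const_dvd_product_split:
  assumes "c \<in> R" "c \<noteq> 0" "G \<in> polys" "H \<in> polys" "K \<in> polys" "[:c:] * K = G * H"
  shows "\<exists>c1\<in>R. \<exists>c2\<in>R. \<exists>G'\<in>polys. \<exists>H'\<in>polys.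
    c = c1 * c2 \<and> G = [:c1:] * G' \<and> H = [:c2:] * H' \<and> K = G' * H'"
  using assms
proof (induction "N c" arbitrary: c G H rule: less_induct)
  case less
  show ?case
  proof (cases "N c = 0")
    case True
    then obtain d where d: "d \<in> R" "c * d = 1" using norm_0_unit less.prems by blast
    have cd: "[:c:] * [:d:] = 1" using d by (simp add: one_pCons mult.commute)
    have "G = [:c:] * ([:d:] * G)" "K = [:d:] * G * H"
      using cd less.prems(6) by (metis mult.assoc mult_1, metis mult.assoc mult.commute mult_1)
    moreover have "H = [:1:] * H" by simp
    moreover have "[:d:] * G \<in> polys" using d less.prems by (intro polys_closed) auto
    ultimately show ?thesis using less.prems one_closed
      by (intro bexI[of _ c] bexI[of _ 1] bexI[of _ "[:d:] * G"] bexI[of _ H] conjI) auto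
  next
    case False
    then obtain q c' where q: "q \<in> R" "c' \<in> R" "c = q * c'" "0 < N q" "q \<noteq> 0"
      and prime: "\<And>b c d. b \<in> R \<Longrightarrow> c \<in> R \<Longrightarrow> d \<in> R \<Longrightarrow> b * c = q * d \<Longrightarrow>
       (\<exists>e\<in>R. b = q * e) \<or> (\<exists>e\<in>R. c = q * e)"
      using exists_prime_divisor[of c] less.prems by (metis neq0_conv)
    have c'nz: "c' \<noteq> 0" using q less.prems by auto
    have small: "N c' < N c" using norm_mult[of q c'] q c'nz by simp
    have pol: "[:q:] \<in> polys" "[:c':] \<in> polys" "[:q:] \<noteq> 0" using q polys_const by auto
    have eq: "G * H = [:q:] * ([:c':] * K)" using less.prems(6) q by (simp add: mult.commute)
    have "[:c':] * K \<in> polys" using q less.prems by (intro polys_closed) auto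
    from const_prime[OF q(1,5) prime less.prems(3,4) this eq]
    show ?thesis
    proof
      assume "\<exists>E\<in>polys. G = [:q:] * E"
      then obtain E where E: "E \<in> polys" "G = [:q:] * E" by blast
      have "[:q:] * ([:c':] * K) = [:q:] * (E * H)" using eq E by (simp add: ac_simps)
      then have "[:c':] * K = E * H"
        using polys_cancel[of "[:q:]"] pol E less.prems polys_mult by metis
      from less.hyps[OF small q(2) c'nz E(1) less.prems(4,5) this] obtain c1 c2 G' H'
        where "c1 \<in> R" "c2 \<in> R" "G' \<in> polys" "H' \<in> polys" "c' = c1 * c2"
          "E = [:c1:] * G'" "H = [:c2:] * H'" "K = G' * H'" by blast
      then show ?thesis using E q mult_closed
        by (intro bexI[of _ "q * c1"] bexI[of _ c2] bexI[of _ G'] bexI[of _ H']) (auto simp: ac_simps)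
    next
      assume "\<exists>E\<in>polys. H = [:q:] * E"
      then obtain E where E: "E \<in> polys" "H = [:q:] * E" by blast
      have "[:q:] * ([:c':] * K) = [:q:] * (G * E)" using eq E by (simp only: ac_simps)
      then have "[:c':] * K = G * E"
        using polys_cancel[of "[:q:]"] pol E less.prems polys_mult by metis
      from less.hyps[OF small q(2) c'nz less.prems(3) E(1) less.prems(5) this] obtain c1 c2 G' H'
        where "c1 \<in> R" "c2 \<in> R" "G' \<in> polys" "H' \<in> polys" "c' = c1 * c2"
          "G = [:c1:] * G'" "E = [:c2:] * H'" "K = G' * H'" by blast
      then show ?thesis using E q mult_closed
        by (intro bexI[of _ c1] bexI[of _ "q * c2"] bexI[of _ G'] bexI[of _ H']) (auto simp: ac_simps)
    qed
  qed
qed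

text \<open>
  Division with remainder becomes possible once the dividend is multiplied by a power of the leading
  coefficient of the divisor. The remainder is described by its coefficients, so that the remainder zero
  needs no separate case.
\<close>

lemma pseudo_division:
  assumes r: "r \<in> polys" "r \<noteq> 0" and "P \<in> polys"
  shows "\<exists>c\<in>R. \<exists>Q\<in>polys. \<exists>S\<in>polys.
    c \<noteq> 0 \<and> [:c:] * P = Q * r + S \<and> (\<forall>k\<ge>degree r. coeff S k = 0)"
proof -
  have "\<exists>c\<in>R. \<exists>Q\<in>polys. \<exists>S\<in>polys.
    c \<noteq> 0 \<and> [:c:] * P = Q * r + S \<and> (\<forall>k\<ge>degree r. coeff S k = 0)"
    if "\<forall>k\<ge>n. coeff P k = 0" "P \<in> polys" for n P
    using that
  proof (induction n arbitrary: P)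
    case 0
    then show ?case using one_closed polys_0
      by (intro bexI[of _ 1] bexI[of _ 0] bexI[of _ P]) auto
  next
    case (Suc n)
    show ?case
    proof (cases "n < degree r")
      case True
      then show ?thesis using Suc.prems one_closed polys_0
        by (intro bexI[of _ 1] bexI[of _ 0] bexI[of _ P]) auto
    next
      case False
      define l where "l = lead_coeff r"
      define M where "M = monom (coeff P n) (n - degree r)"
      define P' where "P' = [:l:] * P - M * r"
      have l: "l \<in> R" "l \<noteq> 0" using r polys_lead_coeff by (auto simp: l_def)
      have M: "M \<in> polys" using Suc.prems unfolding M_def by (intro polys_monom) (auto simp: polys_def)
      have P'0: "\<forall>k\<ge>n. coeff P' k = 0"
      proof (intro allI impI)
        fix k assume nk: "n \<le> k"
        have c: "coeff P' k = l * coeff P k - coeff P n * coeff r (k - (n - degree r))"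
          using nk by (simp add: P'_def M_def coeff_monom_mult)
        show "coeff P' k = 0"
        proof (cases "k = n")
          case True
          then have "k - (n - degree r) = degree r" using False by simp
          with True c show ?thesis by (simp add: l_def)
        next
          case k: False
          then have "coeff P k = 0" using nk Suc.prems by simp
          moreover have "degree r < k - (n - degree r)" using k nk False by simp
          then have "coeff r (k - (n - degree r)) = 0" by (rule coeff_eq_0)
          ultimately show ?thesis using c by simp
        qed
      qed
      have P'R: "P' \<in> polys" unfolding P'_def using l M r Suc.prems
        by (intro polys_closed) auto
      obtain c Q S where c: "c \<in> R" "Q \<in> polys" "S \<in> polys" "c \<noteq> 0"
        "[:c:] * P' = Q * r + S" "\<forall>k\<ge>degree r. coeff S k = 0"
        using Suc.IH[OF P'0 P'R] by blast
      have "[:c * l:] * P = (Q + [:c:] * M) * r + S"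
      proof -
        have "[:c * l:] * P = [:c:] * P' + [:c:] * M * r"
          by (simp add: P'_def algebra_simps smult_diff_right)
        then show ?thesis using c(5) by (simp add: algebra_simps)
      qed
      moreover have "c * l \<in> R" "c * l \<noteq> 0" using c l mult_closed no_zero_div by blast+
      moreover have "Q + [:c:] * M \<in> polys" using c M by (intro polys_closed) auto
      ultimately show ?thesis using c by blast
    qed
  qed
  from this[of "Suc (degree P)" P] show ?thesis using assms(3) by (simp add: coeff_eq_0)
qed

text \<open>
  Let \<open>F\<close> be irreducible of positive degree and divide \<open>G * H\<close>. Up to constants, an element
  \<open>r\<close> of minimal degree in the ideal generated by \<open>F\<close> and \<open>G\<close> divides both of them, by
  pseudo-division. As \<open>F\<close> is irreducible, either \<open>r\<close> is \<open>F\<close> up to constants, and then \<open>F\<close>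
  divides \<open>G\<close>, or \<open>r\<close> is a constant, and then multiplying \<open>r = F * A + G * B\<close> by \<open>H\<close> shows that
  \<open>F\<close> divides \<open>H\<close>. In degree zero the claim is Gauss's lemma.
\<close>

lemma polys_irreducible_prime:
  assumes F: "F \<in> polys" "F \<noteq> 0" "0 < poly_norm F"
    and irr: "\<And>G H. G \<in> polys \<Longrightarrow> H \<in> polys \<Longrightarrow> F = G * H \<Longrightarrow> poly_norm G = 0 \<or> poly_norm H = 0"
    and G: "G \<in> polys" and H: "H \<in> polys" and D: "D \<in> polys" and GH: "G * H = F * D"
  shows "(\<exists>E\<in>polys. G = F * E) \<or> (\<exists>E\<in>polys. H = F * E)"
proof (cases "degree F = 0")
  case True
  then obtain a where Fa: "F = [:a:]" by (rule degree_eq_zeroE)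
  have a: "a \<in> R" "a \<noteq> 0" "0 < N a"
    using F Fa polys_lead_coeff[of F] by (auto simp: poly_norm_def)
  have "N b = 0 \<or> N c = 0" if "b \<in> R" "c \<in> R" "a = b * c" for b c
    using irr[of "[:b:]" "[:c:]"] that Fa polys_const by (auto simp: poly_norm_def)
  note prime = irreducible_prime[OF a this]
  show ?thesis using const_prime[OF a(1,2) _ G H D] prime GH unfolding Fa by blast
next
  case False
  \<comment> \<open>F is primitive, so nonzero constants can be cancelled from divisibility by F.\<close>
  have drop_const: "\<exists>E\<in>polys. K = F * E"
    if cKW: "c \<in> R" "c \<noteq> 0" "K \<in> polys" "W \<in> polys" "[:c:] * K = F * W" for c K W
  proof -
    obtain c1 c2 F' W' where *: "c1 \<in> R" "c2 \<in> R" "F' \<in> polys" "W' \<in> polys"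
      "F = [:c1:] * F'" "K = F' * W'"
      using const_dvd_product_split[OF cKW(1,2) F(1) cKW(4,3,5)] by blast
    have nz: "c1 \<noteq> 0" "F' \<noteq> 0" using F * by auto
    have "degree F = degree F'"
      using * nz polys_degree_mult[of "[:c1:]" F'] polys_const by auto
    then have "poly_norm F' \<noteq> 0" using False by (simp add: poly_norm_def)
    then have "N c1 = 0" using irr[of "[:c1:]" F'] * polys_const by (auto simp: poly_norm_def)
    then obtain d where d: "d \<in> R" "c1 * d = 1" using norm_0_unit * nz by blast
    have "[:c1:] * [:d:] = 1" using d by (simp add: one_pCons mult.commute)
    then have "K = ([:c1:] * [:d:]) * (F' * W')" using * by simp
    also have "\<dots> = F * ([:d:] * W')" unfolding *(5) by (simp only: ac_simps)
    finally have "K = F * ([:d:] * W')" .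
    moreover have "[:d:] * W' \<in> polys" using d * by (intro polys_closed) auto
    ultimately show ?thesis by blast
  qed
  \<comment> \<open>The ideal generated by F and G.\<close>
  define J where "J = {F * A + G * B | A B. A \<in> polys \<and> B \<in> polys}"
  have FJ: "F \<in> J" unfolding J_def
    by (rule CollectI, rule exI[of _ 1], rule exI[of _ 0]) (simp add: polys_0 polys_1)
  have GJ: "G \<in> J" unfolding J_def
    by (rule CollectI, rule exI[of _ 0], rule exI[of _ 1]) (simp add: polys_0 polys_1)
  obtain r where r: "r \<in> J" "r \<noteq> 0" and rmin: "\<And>s. s \<in> J \<Longrightarrow> s \<noteq> 0 \<Longrightarrow> degree r \<le> degree s"
    using ex_has_least_nat[of "\<lambda>s. s \<in> J \<and> s \<noteq> 0" F degree] FJ F by blast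
  obtain A B where AB: "A \<in> polys" "B \<in> polys" "r = F * A + G * B" using r by (auto simp: J_def)
  have rR: "r \<in> polys" unfolding AB(3) using AB F G by (intro polys_closed) auto
  have divJ: "\<exists>c\<in>R. \<exists>Q\<in>polys. c \<noteq> 0 \<and> [:c:] * P = Q * r" if P: "P \<in> J" for P
  proof -
    obtain A' B' where AB': "A' \<in> polys" "B' \<in> polys" "P = F * A' + G * B'"
      using P by (auto simp: J_def)
    have PR: "P \<in> polys" unfolding AB' using AB' F G by (intro polys_closed) auto
    obtain c Q S where c: "c \<in> R" "Q \<in> polys" "S \<in> polys" "c \<noteq> 0"
      "[:c:] * P = Q * r + S" "\<forall>k\<ge>degree r. coeff S k = 0"
      using pseudo_division[OF rR r(2) PR] by blast
    have "S = [:c:] * P - Q * r" using c(5) by simp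
    also have "\<dots> = F * ([:c:] * A' - Q * A) + G * ([:c:] * B' - Q * B)"
      unfolding AB' AB by (simp only: algebra_simps)
    finally have "S = F * ([:c:] * A' - Q * A) + G * ([:c:] * B' - Q * B)" .
    moreover have "[:c:] * A' - Q * A \<in> polys" "[:c:] * B' - Q * B \<in> polys"
      using c AB AB' by (intro polys_closed; simp)+
    ultimately have "S \<in> J" unfolding J_def by blast
    then have "S = 0" using rmin[of S] c(6) by (metis leading_coeff_0_iff)
    then show ?thesis using c by auto
  qed
  obtain c Q where c: "c \<in> R" "c \<noteq> 0" "Q \<in> polys" "[:c:] * F = Q * r"
    using divJ[OF FJ] by blast
  obtain c1 c2 Q' r' where s: "c1 \<in> R" "c2 \<in> R" "Q' \<in> polys" "r' \<in> polys"
    "r = [:c2:] * r'" "F = Q' * r'"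
    using const_dvd_product_split[OF c(1,2,3) rR F(1) c(4)] by blast
  from irr[OF s(3,4,6)] show ?thesis
  proof
    assume "poly_norm r' = 0"
    then have "degree r = 0"
      using s(5) degree_smult_le[of c2 r'] by (simp add: poly_norm_def)
    then obtain a where a: "r = [:a:]" by (rule degree_eq_zeroE)
    then have "a \<in> R" "a \<noteq> 0" using r rR polys_lead_coeff[of r] by auto
    moreover have "[:a:] * H = F * (A * H + D * B)"
    proof -
      have "[:a:] * H = F * A * H + (G * H) * B"
        unfolding a[symmetric] AB(3) by (simp only: algebra_simps)
      then show ?thesis unfolding GH by (simp only: algebra_simps)
    qed
    moreover have "A * H + D * B \<in> polys" using AB H D by (intro polys_closed) auto
    ultimately show ?thesis using drop_const H by blast
  next
    assume "poly_norm Q' = 0"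
    moreover have "Q' \<noteq> 0" using F s by auto
    ultimately obtain U where U: "U \<in> polys" "Q' * U = 1" using poly_norm_0_unit s by blast
    have "r' = (Q' * U) * r'" using U by simp
    then have r'F: "r' = F * U" using s(6) by (simp add: ac_simps)
    obtain c' Q2 where c': "c' \<in> R" "c' \<noteq> 0" "Q2 \<in> polys" "[:c':] * G = Q2 * r"
      using divJ[OF GJ] by blast
    have "[:c':] * G = F * (U * [:c2:] * Q2)"
      unfolding c' s(5) r'F by (simp only: ac_simps)
    moreover have "U * [:c2:] * Q2 \<in> polys" using U c' s by (intro polys_closed) auto
    ultimately show ?thesis using drop_const c' G by blast
  qed
qed

theorem polys_factorial: "factorial_subring polys poly_norm"
proof
  fix a b :: "'a poly"
  show "a \<in> polys \<Longrightarrow> b \<in> polys \<Longrightarrow> a * b = 0 \<Longrightarrow> a = 0 \<or> b = 0"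
    using polys_mult_nonzero by blast
qed (use polys_closed poly_norm_mult poly_norm_0_unit polys_irreducible_prime in auto)

theorem factorial_image:
  fixes h :: "'a \<Rightarrow> 'b::comm_ring_1"
  assumes add: "\<And>a b. a \<in> R \<Longrightarrow> b \<in> R \<Longrightarrow> h (a + b) = h a + h b"
    and mult: "\<And>a b. a \<in> R \<Longrightarrow> b \<in> R \<Longrightarrow> h (a * b) = h a * h b"
    and one: "h 1 = 1" and inj: "inj_on h R"
  shows "factorial_subring (h ` R) (N \<circ> inv_into R h)"
proof -
  have zero: "h 0 = 0" using add[of 0 0] zero_closed by simp
  have um: "h (- a) = - h a" if "a \<in> R" for a
    using add[of a "- a"] that uminus_closed zero by (simp add: eq_neg_iff_add_eq_0 add.commute)
  have iff0: "h a = 0 \<longleftrightarrow> a = 0" if "a \<in> R" for a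
    using inj_onD[OF inj, of a 0] that zero_closed zero by auto
  have iff: "h a = h b \<longleftrightarrow> a = b" if "a \<in> R" "b \<in> R" for a b
    using inj_onD[OF inj] that by blast
  have inv: "inv_into R h (h a) = a" if "a \<in> R" for a using that inj by simp
  note simps = mult[symmetric] add[symmetric] um[symmetric] inv iff iff0 mult_closed add_closed uminus_closed
  show ?thesis
  proof
    show "0 \<in> h ` R" using zero zero_closed by (metis image_eqI)
    show "1 \<in> h ` R" using one one_closed by (metis image_eqI)
  next
    fix a b assume "a \<in> h ` R" "b \<in> h ` R"
    then show "a + b \<in> h ` R" "a * b \<in> h ` R" by (auto simp: simps)
  next
    fix a assume "a \<in> h ` R"
    then show "- a \<in> h ` R" by (auto simp: simps)
  next
    fix a b assume "a \<in> h ` R" "b \<in> h ` R" "a * b = 0"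
    then show "a = 0 \<or> b = 0" by (auto simp: simps zero dest: no_zero_div)
  next
    fix a b assume "a \<in> h ` R" "b \<in> h ` R" "a \<noteq> 0" "b \<noteq> 0"
    then show "(N \<circ> inv_into R h) (a * b) = (N \<circ> inv_into R h) a + (N \<circ> inv_into R h) b"
      using norm_mult by (auto simp: simps zero)
  next
    fix a assume "a \<in> h ` R" "a \<noteq> 0" "(N \<circ> inv_into R h) a = 0"
    then obtain a' where a': "a' \<in> R" "a = h a'" "a' \<noteq> 0" "N a' = 0" by (auto simp: simps zero)
    then obtain b where "b \<in> R" "a' * b = 1" using norm_0_unit by blast
    then show "\<exists>b\<in>h ` R. a * b = 1" using a' one by (intro bexI[of _ "h b"]) (auto simp: simps)
  next
    fix a b c d
    assume a: "a \<in> h ` R" "a \<noteq> 0" "0 < (N \<circ> inv_into R h) a"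
      and irr: "\<And>b c. b \<in> h ` R \<Longrightarrow> c \<in> h ` R \<Longrightarrow> a = b * c \<Longrightarrow>
         (N \<circ> inv_into R h) b = 0 \<or> (N \<circ> inv_into R h) c = 0"
      and bcd: "b \<in> h ` R" "c \<in> h ` R" "d \<in> h ` R" "b * c = a * d"
    obtain a' where a': "a' \<in> R" "a = h a'" "a' \<noteq> 0" "0 < N a'" using a zero by (auto simp: simps)
    have irr': "N b = 0 \<or> N c = 0" if "b \<in> R" "c \<in> R" "a' = b * c" for b c
      using irr[of "h b" "h c"] that a' by (auto simp: simps)
    obtain b' c' d' where "b' \<in> R" "c' \<in> R" "d' \<in> R" "b = h b'" "c = h c'" "d = h d'"
      using bcd by blast
    moreover from this have "b' * c' = a' * d'" using bcd(4) a' by (simp add: simps)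
    ultimately show "(\<exists>e\<in>h ` R. b = a * e) \<or> (\<exists>e\<in>h ` R. c = a * e)"
      using irreducible_prime[OF a'(1,3,4) irr'] a' mult by blast
  qed
qed

end

section \<open>Unique factorization in several variables\<close>

text \<open>
  Linear questions about polynomials are reduced to monomials by this decomposition.
\<close>

lemma poly_mapping_eq_sum_single: "p = (\<Sum>m\<in>Poly_Mapping.keys p. Poly_Mapping.single m (Poly_Mapping.lookup p m))"
proof (rule poly_mapping_eqI)
  fix k
  have "(\<Sum>m\<in>Poly_Mapping.keys p. Poly_Mapping.lookup (Poly_Mapping.single m (Poly_Mapping.lookup p m)) k)
    = (\<Sum>m\<in>Poly_Mapping.keys p. if m = k then Poly_Mapping.lookup p m else 0)"
    by (intro sum.cong) (auto simp: lookup_single when_def)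
  also have "\<dots> = Poly_Mapping.lookup p k"
    by (simp add: in_keys_iff)
  finally show "Poly_Mapping.lookup p k = Poly_Mapping.lookup
    (\<Sum>m\<in>Poly_Mapping.keys p. Poly_Mapping.single m (Poly_Mapping.lookup p m)) k"
    by (simp add: lookup_sum)
qed

lemma eval_superset:
  assumes "finite S" "Poly_Mapping.keys p \<subseteq> S"
  shows "rpoly_eval p x = (\<Sum>m\<in>S. Poly_Mapping.lookup p m * (\<Prod>i\<in>UNIV. (x $ i) ^ Poly_Mapping.lookup m i))"
  unfolding rpoly_eval_def using assms by (intro sum.mono_neutral_left) (auto simp: in_keys_iff)

lemma eval_zero [simp]: "rpoly_eval 0 x = 0"
  by (simp add: rpoly_eval_def)

lemma eval_single:
  "rpoly_eval (Poly_Mapping.single m c) x = c * (\<Prod>i\<in>UNIV. (x $ i) ^ Poly_Mapping.lookup m i)"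
  using eval_superset[of "{m}" "Poly_Mapping.single m c" x] by simp

lemma eval_one [simp]: "rpoly_eval 1 x = 1"
  using eval_single[of 0 1 x] by simp

lemma eval_add [simp]: "rpoly_eval (p + q) x = rpoly_eval p x + rpoly_eval q x"
proof -
  let ?S = "Poly_Mapping.keys p \<union> Poly_Mapping.keys q"
  show ?thesis
    using eval_superset[of ?S p x] eval_superset[of ?S q x] eval_superset[of ?S "p + q" x] keys_add[of p q]
    by (simp add: lookup_add distrib_right sum.distrib)
qed

lemma eval_sum: "rpoly_eval (\<Sum>i\<in>I. g i) x = (\<Sum>i\<in>I. rpoly_eval (g i) x)"
  by (induction I rule: infinite_finite_induct) auto

lemma eval_mult [simp]: "rpoly_eval (p * q) x = rpoly_eval p x * rpoly_eval q x"
proof -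
  let ?s = "\<lambda>p m. Poly_Mapping.single m (Poly_Mapping.lookup p m)"
  have "p * q = (\<Sum>m\<in>Poly_Mapping.keys p. \<Sum>m'\<in>Poly_Mapping.keys q. ?s p m * ?s q m')"
    by (subst (1) poly_mapping_eq_sum_single[of p], subst (1) poly_mapping_eq_sum_single[of q])
      (simp add: sum_product)
  then have "rpoly_eval (p * q) x =
    (\<Sum>m\<in>Poly_Mapping.keys p. \<Sum>m'\<in>Poly_Mapping.keys q. rpoly_eval (?s p m * ?s q m') x)"
    by (simp add: eval_sum)
  also have "\<dots> = (\<Sum>m\<in>Poly_Mapping.keys p. \<Sum>m'\<in>Poly_Mapping.keys q.
    rpoly_eval (?s p m) x * rpoly_eval (?s q m') x)"
    by (simp add: mult_single eval_single lookup_add power_add prod.distrib ac_simps)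
  also have "\<dots> = (\<Sum>m\<in>Poly_Mapping.keys p. rpoly_eval (?s p m) x) *
    (\<Sum>m'\<in>Poly_Mapping.keys q. rpoly_eval (?s q m') x)"
    by (simp add: sum_product)
  also have "\<dots> = rpoly_eval p x * rpoly_eval q x"
    unfolding eval_single by (simp add: rpoly_eval_def)
  finally show ?thesis .
qed

lemma eval_power [simp]: "rpoly_eval (p ^ k) x = rpoly_eval p x ^ k"
  by (induction k) auto

lemma eval_prod: "rpoly_eval (\<Prod>i\<in>I. g i) x = (\<Prod>i\<in>I. rpoly_eval (g i) x)"
  by (induction I rule: infinite_finite_induct) auto

lemma continuous_eval: "continuous_on UNIV (rpoly_eval p)"
  unfolding rpoly_eval_def[abs_def] by (intro continuous_intros)

text \<open>
  These subrings of a single type make an induction over the set of variables possible.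
\<close>

definition polys_in :: "'n::finite set \<Rightarrow> 'n rpoly set" where
  "polys_in V = {p. \<forall>m\<in>Poly_Mapping.keys p. Poly_Mapping.keys m \<subseteq> V}"

definition rvar :: "'n::finite \<Rightarrow> 'n rpoly" where
  "rvar i = Poly_Mapping.single (Poly_Mapping.single i 1) 1"

lemma eval_rvar: "rpoly_eval (rvar i) x = x $ i"
proof -
  have "rpoly_eval (rvar i) x = (\<Prod>j\<in>UNIV. if j = i then x $ j else 1)"
    unfolding rvar_def eval_single mult_1 by (intro prod.cong) (auto simp: lookup_single when_def)
  then show ?thesis by simp
qed

lemma polys_in_UNIV: "polys_in UNIV = UNIV"
  by (simp add: polys_in_def)

lemma rvar_power: "rvar i ^ k = Poly_Mapping.single (Poly_Mapping.single i k) 1"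
  by (induction k) (auto simp: rvar_def mult_single single_add[symmetric])

lemma lookup_rvar_mult:
  "Poly_Mapping.lookup (rvar i * q) m =
    (if Poly_Mapping.lookup m i = 0 then 0 else Poly_Mapping.lookup q (m - Poly_Mapping.single i 1))"
proof -
  let ?e = "Poly_Mapping.single i (1::nat)"
  have iff: "m = ?e + n \<longleftrightarrow> Poly_Mapping.lookup m i \<noteq> 0 \<and> n = m - ?e" for n
  proof
    assume "Poly_Mapping.lookup m i \<noteq> 0 \<and> n = m - ?e"
    then show "m = ?e + n"
      by (intro poly_mapping_eqI) (auto simp: lookup_add lookup_minus lookup_single when_def)
  qed (auto simp: lookup_add)
  have "rvar i * q = (\<Sum>n\<in>Poly_Mapping.keys q. Poly_Mapping.single (?e + n) (Poly_Mapping.lookup q n))"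
    by (subst (1) poly_mapping_eq_sum_single[of q]) (simp add: rvar_def sum_distrib_left mult_single)
  then have "Poly_Mapping.lookup (rvar i * q) m =
    (\<Sum>n\<in>Poly_Mapping.keys q. Poly_Mapping.lookup q n when ?e + n = m)"
    by (simp add: lookup_sum lookup_single)
  also have "\<dots> = (\<Sum>n\<in>Poly_Mapping.keys q.
      if n = m - ?e then (if Poly_Mapping.lookup m i = 0 then 0 else Poly_Mapping.lookup q n) else 0)"
  proof (intro sum.cong refl)
    fix n
    show "(Poly_Mapping.lookup q n when ?e + n = m) =
      (if n = m - ?e then (if Poly_Mapping.lookup m i = 0 then 0 else Poly_Mapping.lookup q n) else 0)"
    proof (cases "m = ?e + n")
      case True
      with iff[of n] have "Poly_Mapping.lookup m i \<noteq> 0" "n = m - ?e" by blast+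
      then show ?thesis using True by (metis when_simps(1))
    next
      case False
      with iff[of n] have "Poly_Mapping.lookup m i = 0 \<or> n \<noteq> m - ?e" by blast
      then show ?thesis using False by (metis when_simps(2))
    qed
  qed
  also have "\<dots> = (if Poly_Mapping.lookup m i = 0 then 0 else Poly_Mapping.lookup q (m - ?e))"
    by (auto simp: in_keys_iff)
  finally show ?thesis .
qed

lemma lookup_polys_in_eq_0:
  assumes "a \<in> polys_in V" "i \<notin> V" "Poly_Mapping.lookup m i \<noteq> 0"
  shows "Poly_Mapping.lookup a m = 0"
proof -
  have "i \<in> Poly_Mapping.keys m" using assms(3) by (simp add: in_keys_iff)
  then have "m \<notin> Poly_Mapping.keys a" using assms by (auto simp: polys_in_def)
  then show ?thesis by (simp add: in_keys_iff)
qed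

lemma lookup_poly_rvar:
  assumes "\<And>k. coeff F k \<in> polys_in V" "i \<notin> V"
  shows "Poly_Mapping.lookup (poly F (rvar i)) m =
    Poly_Mapping.lookup (coeff F (Poly_Mapping.lookup m i)) (m - Poly_Mapping.single i (Poly_Mapping.lookup m i))"
  using assms(1)
proof (induction F arbitrary: m)
  case 0
  then show ?case by simp
next
  case (pCons a F)
  have a: "a \<in> polys_in V" and F: "coeff F k \<in> polys_in V" for k
    using pCons.prems[of 0] pCons.prems[of "Suc k"] by auto
  show ?case
  proof (cases "Poly_Mapping.lookup m i")
    case 0
    then show ?thesis by (simp add: lookup_add lookup_rvar_mult)
  next
    case (Suc k)
    have "Poly_Mapping.lookup a m = 0"
      using lookup_polys_in_eq_0[OF a assms(2)] Suc by simp
    moreover have "m - Poly_Mapping.single i (Suc 0) - Poly_Mapping.single i k = m - Poly_Mapping.single i (Suc k)"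
      by (intro poly_mapping_eqI) (auto simp: lookup_minus lookup_single when_def)
    ultimately show ?thesis
      using Suc pCons.IH[OF F, of "m - Poly_Mapping.single i 1"]
      by (simp add: lookup_add lookup_rvar_mult in_keys_iff lookup_minus)
  qed
qed

text \<open>
  A new variable \<open>x\<^sub>i\<close> is transcendental over the polynomials in the other variables; together with
  the next lemmas this identifies the polynomials in \<open>V \<union> {i}\<close> with univariate polynomials in \<open>x\<^sub>i\<close>.
\<close>

lemma poly_rvar_inj:
  assumes F: "\<And>k. coeff F k \<in> polys_in V" and G: "\<And>k. coeff G k \<in> polys_in V" and i: "i \<notin> V"
    and eq: "poly F (rvar i) = poly G (rvar i)"
  shows "F = G"
proof (intro poly_eqI poly_mapping_eqI)
  fix k m
  show "Poly_Mapping.lookup (coeff F k) m = Poly_Mapping.lookup (coeff G k) m"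
  proof (cases "Poly_Mapping.lookup m i = 0")
    case True
    let ?m = "m + Poly_Mapping.single i k"
    have "Poly_Mapping.lookup ?m i = k" by (simp add: lookup_add True)
    moreover have "?m - Poly_Mapping.single i k = m" by simp
    ultimately show ?thesis
      using lookup_poly_rvar[OF F i, of ?m] lookup_poly_rvar[OF G i, of ?m] eq by simp
  next
    case False
    have "Poly_Mapping.lookup (coeff H k) m = 0" if "\<And>k. coeff H k \<in> polys_in V" for H
      using lookup_polys_in_eq_0[OF that i] False by simp
    then show ?thesis using F G by simp
  qed
qed

lemma polys_in_empty: "polys_in {} = range (Poly_Mapping.single (0 :: 'n::finite \<Rightarrow>\<^sub>0 nat))"
proof (intro equalityI subsetI)
  fix p :: "'n rpoly" assume "p \<in> polys_in {}"
  then have k: "Poly_Mapping.keys p \<subseteq> {0}" by (auto simp: polys_in_def)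
  have "p = Poly_Mapping.single 0 (Poly_Mapping.lookup p 0)"
    using k by (intro poly_mapping_eqI) (auto simp: lookup_single when_def in_keys_iff)
  then show "p \<in> range (Poly_Mapping.single 0)" by blast
qed (auto simp: polys_in_def split: if_splits)

lemma factorial_constants:
  "factorial_subring (polys_in {} :: 'n::finite rpoly set) (\<lambda>_. 0)"
proof
  fix a :: "'n rpoly" assume "a \<in> polys_in {}" "a \<noteq> 0"
  then obtain c where "a = Poly_Mapping.single 0 c" by (auto simp: polys_in_empty)
  moreover from this \<open>a \<noteq> 0\<close> have "c \<noteq> 0" by auto
  ultimately show "\<exists>b\<in>polys_in {}. a * b = 1"
    by (intro bexI[of _ "Poly_Mapping.single 0 (1 / c)"]) (auto simp: polys_in_empty mult_single)
next
  fix a b :: "'n rpoly" assume "a \<in> polys_in {}" "b \<in> polys_in {}" and ab: "a * b = 0"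
  then obtain c d where cd: "a = Poly_Mapping.single 0 c" "b = Poly_Mapping.single 0 d"
    by (auto simp: polys_in_empty)
  then have "c * d = 0"
    using arg_cong[OF ab, of "\<lambda>p. Poly_Mapping.lookup p 0"] by (simp add: mult_single)
  then show "a = 0 \<or> b = 0" using cd by auto
qed (auto simp: polys_in_empty mult_single single_add[symmetric] single_uminus[symmetric]
  intro: range_eqI[of _ _ 0] range_eqI[of _ _ 1])

lemma polys_in_insert:
  assumes "factorial_subring (polys_in V) N" "i \<notin> V"
  shows "(\<lambda>F. poly F (rvar i)) ` factorial_subring.polys (polys_in V) = polys_in (insert i V)"
proof -
  interpret factorial_subring "polys_in V" N by fact
  show ?thesis
  proof (intro equalityI subsetI)
    fix p assume "p \<in> (\<lambda>F. poly F (rvar i)) ` polys"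
    then obtain F where F: "\<And>k. coeff F k \<in> polys_in V" "p = poly F (rvar i)" by (auto simp: polys_def)
    show "p \<in> polys_in (insert i V)"
      unfolding polys_in_def
    proof (intro CollectI ballI subsetI)
      fix m j assume m: "m \<in> Poly_Mapping.keys p" and j: "j \<in> Poly_Mapping.keys m"
      let ?m = "m - Poly_Mapping.single i (Poly_Mapping.lookup m i)"
      have "?m \<in> Poly_Mapping.keys (coeff F (Poly_Mapping.lookup m i))"
        using m lookup_poly_rvar[OF F(1) assms(2), of m] F(2) by (simp add: in_keys_iff)
      then have "Poly_Mapping.keys ?m \<subseteq> V" using F(1) by (auto simp: polys_in_def)
      moreover have "j \<in> Poly_Mapping.keys ?m" if "j \<noteq> i"
        using j that by (simp add: in_keys_iff lookup_minus lookup_single)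
      ultimately show "j \<in> insert i V" by blast
    qed
  next
    fix p assume p: "p \<in> polys_in (insert i V)"
    have single: "Poly_Mapping.single m c \<in> (\<lambda>F. poly F (rvar i)) ` polys"
      if m: "m \<in> Poly_Mapping.keys p" for m c
    proof -
      let ?k = "Poly_Mapping.lookup m i"
      let ?m = "m - Poly_Mapping.single i ?k"
      have "Poly_Mapping.keys m \<subseteq> insert i V" using p m by (auto simp: polys_in_def)
      moreover have "Poly_Mapping.keys ?m \<subseteq> Poly_Mapping.keys m - {i}"
        by (auto simp: in_keys_iff lookup_minus lookup_single when_def split: if_splits)
      ultimately have "Poly_Mapping.keys ?m \<subseteq> V" by blast
      then have "Poly_Mapping.single ?m c \<in> polys_in V" by (auto simp: polys_in_def)
      then have "monom (Poly_Mapping.single ?m c) ?k \<in> polys" by (rule polys_monom)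
      moreover have "?m + Poly_Mapping.single i ?k = m"
        by (intro poly_mapping_eqI) (auto simp: lookup_add lookup_minus lookup_single when_def)
      then have "poly (monom (Poly_Mapping.single ?m c) ?k) (rvar i) = Poly_Mapping.single m c"
        by (simp add: poly_monom rvar_power mult_single)
      ultimately show ?thesis by (metis image_eqI)
    qed
    have "(\<Sum>m\<in>S. Poly_Mapping.single m (Poly_Mapping.lookup p m)) \<in> (\<lambda>F. poly F (rvar i)) ` polys"
      if "finite S" "S \<subseteq> Poly_Mapping.keys p" for S
      using that
    proof (induction S)
      case empty
      then show ?case using polys_0 by (auto intro!: image_eqI[of _ _ 0])
    next
      case (insert m S)
      then obtain F G where "F \<in> polys" "G \<in> polys"
        "poly F (rvar i) = Poly_Mapping.single m (Poly_Mapping.lookup p m)"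
        "poly G (rvar i) = (\<Sum>m\<in>S. Poly_Mapping.single m (Poly_Mapping.lookup p m))"
        using single[of m "Poly_Mapping.lookup p m"] by auto
      then show ?case using insert polys_add by (auto intro!: image_eqI[of _ _ "F + G"])
    qed
    from this[of "Poly_Mapping.keys p"] show "p \<in> (\<lambda>F. poly F (rvar i)) ` polys"
      using poly_mapping_eq_sum_single[of p] by simp
  qed
qed

theorem factorial_polys_in:
  fixes V :: "'n::finite set"
  shows "\<exists>N. factorial_subring (polys_in V) N"
proof (induction V rule: finite_induct[OF finite])
  case 1
  then show ?case using factorial_constants by blast
next
  case (2 i V)
  then obtain N where N: "factorial_subring (polys_in V) N" by blast
  then interpret R: factorial_subring "polys_in V" N .
  interpret RX: factorial_subring R.polys R.poly_norm by (rule R.polys_factorial)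
  have "factorial_subring ((\<lambda>F. poly F (rvar i)) ` R.polys)
    (R.poly_norm \<circ> inv_into R.polys (\<lambda>F. poly F (rvar i)))"
  proof (rule RX.factorial_image)
    show "inj_on (\<lambda>F. poly F (rvar i)) R.polys"
    proof (rule inj_onI)
      fix F G assume "F \<in> R.polys" "G \<in> R.polys" "poly F (rvar i) = poly G (rvar i)"
      then show "F = G" using poly_rvar_inj[OF _ _ 2(2), of F G] by (simp add: R.polys_def)
    qed
  qed auto
  then show ?case using polys_in_insert[OF N 2(2)] by metis
qed

text \<open>
  The case of all variables, restated in terms of the divisibility relation of the type.
  Multiplicities are finite because \<open>f ^ k dvd a\<close> forces the norm of \<open>a\<close> to be at least \<open>k\<close>.
\<close>

lemma
  fixes f a b :: "'n::finite rpoly"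
  shows rpoly_no_zero_div: "a * b = 0 \<Longrightarrow> a = 0 \<or> b = 0"
    and irreducible_dvd_mult: "irreducible f \<Longrightarrow> f dvd a * b \<Longrightarrow> f dvd a \<or> f dvd b"
    and finite_multiplicity: "irreducible f \<Longrightarrow> a \<noteq> 0 \<Longrightarrow> \<exists>k. f ^ k dvd a \<and> \<not> f ^ Suc k dvd a"
proof -
  obtain N :: "'n rpoly \<Rightarrow> nat" where "factorial_subring (polys_in UNIV) N"
    using factorial_polys_in by blast
  then interpret factorial_subring "UNIV :: 'n rpoly set" N by (simp add: polys_in_UNIV)
  show "a * b = 0 \<Longrightarrow> a = 0 \<or> b = 0" by (rule no_zero_div) auto
  have unit: "N c = 0 \<longleftrightarrow> c dvd 1" if "c \<noteq> 0" for c
  proof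
    assume "N c = 0"
    then obtain d where "c * d = 1" using norm_0_unit[of c] \<open>c \<noteq> 0\<close> by auto
    then show "c dvd 1" by (rule dvdI[OF sym])
  next
    assume "c dvd 1"
    then obtain d where "1 = c * d" by (rule dvdE)
    moreover from this have "d \<noteq> 0" by auto
    ultimately show "N c = 0" using norm_mult[of c d] that norm_1 by simp
  qed
  show "f dvd a \<or> f dvd b" if f: "irreducible f" and "f dvd a * b"
  proof -
    obtain d where d: "a * b = f * d" using \<open>f dvd a * b\<close> by (rule dvdE)
    have nz: "f \<noteq> 0" and nu: "\<not> f dvd 1" using f by (auto simp: irreducible_def)
    have irr: "N b = 0 \<or> N c = 0" if "f = b * c" for b c
    proof -
      have "b \<noteq> 0" "c \<noteq> 0" using nz that by auto
      then have "N b = 0 \<longleftrightarrow> b dvd 1" "N c = 0 \<longleftrightarrow> c dvd 1" by (simp_all add: unit)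
      with irreducibleD[OF f that] show ?thesis by metis
    qed
    have "0 < N f" using unit[OF nz] nu by simp
    then have "(\<exists>e\<in>UNIV. a = f * e) \<or> (\<exists>e\<in>UNIV. b = f * e)"
      using irreducible_prime[OF UNIV_I nz _ irr UNIV_I UNIV_I UNIV_I d] by blast
    then show ?thesis by (metis dvdI)
  qed
  show "\<exists>k. f ^ k dvd a \<and> \<not> f ^ Suc k dvd a" if f: "irreducible f" and a: "a \<noteq> 0"
  proof (rule ccontr)
    assume "\<not> ?thesis"
    then have step: "f ^ k dvd a \<Longrightarrow> f ^ Suc k dvd a" for k by blast
    have dvd: "f ^ k dvd a" for k by (induction k) (use step in auto)
    have nz: "f \<noteq> 0" using f by (auto simp: irreducible_def)
    then have "0 < N f" using unit[OF nz] f by (auto simp: irreducible_def)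
    have pow: "f ^ k \<noteq> 0 \<and> N (f ^ k) = k * N f" for k
    proof (induction k)
      case (Suc k)
      then show ?case using norm_mult[of f "f ^ k"] no_zero_div[of f "f ^ k"] nz by auto
    qed (simp add: norm_1)
    obtain c where c: "a = f ^ Suc (N a) * c" using dvd by (rule dvdE)
    then have "c \<noteq> 0" using a by auto
    then have "N (f ^ Suc (N a) * c) = Suc (N a) * N f + N c"
      using norm_mult[OF UNIV_I UNIV_I, of "f ^ Suc (N a)" c] pow[of "Suc (N a)"] by simp
    then have "N a = Suc (N a) * N f + N c" by (simp only: c[symmetric])
    moreover have "Suc (N a) \<le> Suc (N a) * N f" using \<open>0 < N f\<close> by (cases "N f") simp_all
    ultimately show False by linarith
  qed
qed

section \<open>Chains of prime ideals in the polynomial ring\<close>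

text \<open>
  Gaussian elimination of one equation and one unknown at a time.
\<close>

lemma homogeneous_system_solution:
  fixes a :: "'e \<Rightarrow> 'm \<Rightarrow> real"
  assumes "finite M" "finite E" "card M < card E"
  shows "\<exists>c. (\<exists>e\<in>E. c e \<noteq> 0) \<and> (\<forall>m\<in>M. (\<Sum>e\<in>E. c e * a e m) = 0)"
  using assms
proof (induction M arbitrary: E a rule: finite_induct)
  case empty
  then have "E \<noteq> {}" by auto
  then show ?case by (intro exI[of _ "\<lambda>_. 1"]) auto
next
  case (insert m M)
  show ?case
  proof (cases "\<forall>e\<in>E. a e m = 0")
    case True
    obtain c where "\<exists>e\<in>E. c e \<noteq> 0" "\<forall>k\<in>M. (\<Sum>e\<in>E. c e * a e k) = 0"
      using insert.IH[of E a] insert.prems insert.hyps by auto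
    then show ?thesis using True by (intro exI[of _ c]) auto
  next
    case False
    then obtain e0 where e0: "e0 \<in> E" "a e0 m \<noteq> 0" by blast
    let ?E = "E - {e0}"
    define a' where "a' e k = a e k - a e m / a e0 m * a e0 k" for e k
    have "card M < card ?E" using insert.prems insert.hyps e0 by auto
    then obtain c' where c': "\<exists>e\<in>?E. c' e \<noteq> 0" "\<forall>k\<in>M. (\<Sum>e\<in>?E. c' e * a' e k) = 0"
      using insert.IH[of ?E a'] insert.prems by auto
    define s where "s = (\<Sum>e\<in>?E. c' e * a e m)"
    define c where "c e = (if e = e0 then - s / a e0 m else c' e)" for e
    have sum_c: "(\<Sum>e\<in>E. c e * a e k) = (\<Sum>e\<in>?E. c' e * a e k) - s / a e0 m * a e0 k" for k
    proof -
      have "(\<Sum>e\<in>E. c e * a e k) = c e0 * a e0 k + (\<Sum>e\<in>?E. c e * a e k)"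
        using e0 insert.prems by (intro sum.remove) auto
      also have "(\<Sum>e\<in>?E. c e * a e k) = (\<Sum>e\<in>?E. c' e * a e k)"
        by (intro sum.cong) (auto simp: c_def)
      finally show ?thesis by (simp add: c_def)
    qed
    have "(\<Sum>e\<in>E. c e * a e k) = 0" if "k \<in> M" for k
    proof -
      have "(\<Sum>e\<in>?E. c' e * a' e k) = (\<Sum>e\<in>?E. c' e * a e k) - s / a e0 m * a e0 k"
        unfolding a'_def s_def
        by (simp add: right_diff_distrib sum_subtractf sum_distrib_right sum_divide_distrib mult.assoc)
      then show ?thesis using c' that sum_c[of k] by simp
    qed
    moreover have "(\<Sum>e\<in>E. c e * a e m) = 0" using sum_c[of m] e0 by (simp add: s_def)
    moreover have "\<exists>e\<in>E. c e \<noteq> 0" using c'(1) by (auto simp: c_def)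
    ultimately show ?thesis by (intro exI[of _ c]) auto
  qed
qed

definition degree_box :: "nat \<Rightarrow> ('n::finite \<Rightarrow>\<^sub>0 nat) set" where
  "degree_box k = {m. \<forall>i. Poly_Mapping.lookup m i \<le> k}"

lemma degree_box_mono: "k \<le> l \<Longrightarrow> degree_box k \<subseteq> degree_box l"
  by (auto simp: degree_box_def intro: order_trans)

lemma
  shows finite_degree_box: "finite (degree_box k :: ('n::finite \<Rightarrow>\<^sub>0 nat) set)"
    and card_degree_box: "card (degree_box k :: ('n \<Rightarrow>\<^sub>0 nat) set) \<le> Suc k ^ CARD('n)"
proof -
  let ?B = "degree_box k :: ('n \<Rightarrow>\<^sub>0 nat) set"
  let ?F = "PiE UNIV (\<lambda>_. {..k}) :: ('n \<Rightarrow> nat) set"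
  have inj: "inj_on Poly_Mapping.lookup ?B" by (rule inj_onI) simp
  have sub: "Poly_Mapping.lookup ` ?B \<subseteq> ?F" by (auto simp: degree_box_def)
  have fin: "finite ?F" by (intro finite_PiE) auto
  show "finite ?B" by (rule finite_imageD[OF finite_subset[OF sub fin] inj])
  show "card ?B \<le> Suc k ^ CARD('n)"
    using card_inj_on_le[OF inj sub fin] by (simp add: card_PiE)
qed

lemma keys_mult_degree_box:
  assumes "Poly_Mapping.keys p \<subseteq> degree_box k" "Poly_Mapping.keys q \<subseteq> degree_box l"
  shows "Poly_Mapping.keys (p * q :: 'n::finite rpoly) \<subseteq> degree_box (k + l)"
proof
  fix m assume "m \<in> Poly_Mapping.keys (p * q)"
  then obtain u v where "m = u + v" "u \<in> Poly_Mapping.keys p" "v \<in> Poly_Mapping.keys q"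
    using keys_mult[of p q] by blast
  then show "m \<in> degree_box (k + l)"
    using assms by (auto simp: degree_box_def lookup_add subset_iff intro!: add_mono)
qed

lemma keys_power_degree_box:
  assumes "Poly_Mapping.keys p \<subseteq> degree_box k"
  shows "Poly_Mapping.keys (p ^ n :: 'n::finite rpoly) \<subseteq> degree_box (k * n)"
proof (induction n)
  case 0
  then show ?case by (simp add: degree_box_def)
next
  case (Suc n)
  then show ?case using keys_mult_degree_box[OF assms Suc] by simp
qed

lemma lookup_const_mult:
  "Poly_Mapping.lookup (Poly_Mapping.single 0 c * p) m = c * Poly_Mapping.lookup (p :: 'n::finite rpoly) m"
proof -
  have "Poly_Mapping.single 0 c * p = (\<Sum>k\<in>Poly_Mapping.keys p. Poly_Mapping.single k (c * Poly_Mapping.lookup p k))"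
    by (subst (1) poly_mapping_eq_sum_single[of p]) (simp add: sum_distrib_left mult_single)
  then show ?thesis
    by (simp add: lookup_sum lookup_single when_def in_keys_iff)
qed

fun monomial_value :: "'a::comm_monoid_mult list \<Rightarrow> nat list \<Rightarrow> 'a" where
  "monomial_value (x # xs) (k # ks) = x ^ k * monomial_value xs ks"
| "monomial_value _ _ = 1"

lemma keys_monomial_value:
  assumes "\<forall>x\<in>set xs. Poly_Mapping.keys x \<subseteq> degree_box D" "set e \<subseteq> {..N}"
  shows "Poly_Mapping.keys (monomial_value xs e :: 'n::finite rpoly) \<subseteq> degree_box (D * N * length xs)"
  using assms
proof (induction xs e rule: monomial_value.induct)
  case (1 x xs k ks)
  have "Poly_Mapping.keys (x ^ k) \<subseteq> degree_box (D * k)"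
    using 1 by (intro keys_power_degree_box) auto
  also have "\<dots> \<subseteq> degree_box (D * N)"
    using 1 by (intro degree_box_mono) auto
  finally have "Poly_Mapping.keys (x ^ k) \<subseteq> degree_box (D * N)" .
  moreover have "Poly_Mapping.keys (monomial_value xs ks) \<subseteq> degree_box (D * N * length xs)"
    using 1 by simp
  ultimately show ?case
    using keys_mult_degree_box[of "x ^ k" "D * N" "monomial_value xs ks"] by simp
qed (auto simp: degree_box_def)

text \<open>
  This holds by counting, with \<open>d\<close> the number of variables.
  There are \<open>(N + 1) ^ n\<close> power products of \<open>n\<close> given polynomials with exponents up to \<open>N\<close>, and they lie
  in a space of dimension at most \<open>(C * (N + 1)) ^ d\<close> with \<open>C\<close> independent of \<open>N\<close>. For \<open>n > d\<close> and
  \<open>N = C ^ d\<close> the first number is the larger one.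
\<close>

theorem algebraic_dependence:
  fixes xs :: "'n::finite rpoly list"
  assumes "CARD('n) < length xs"
  obtains E c where "finite E" "\<forall>e\<in>E. length e = length xs" "\<exists>e\<in>E. c e \<noteq> 0"
    "(\<Sum>e\<in>E. Poly_Mapping.single 0 (c e) * monomial_value xs e) = 0"
proof -
  define M where "M = (\<Union>x\<in>set xs. \<Union>m\<in>Poly_Mapping.keys x. range (Poly_Mapping.lookup m))"
  have "finite M" unfolding M_def by auto
  then have "\<exists>D. \<forall>y\<in>M. y \<le> D" by (meson finite_nat_set_iff_bounded_le)
  then obtain D where "\<forall>y\<in>M. y \<le> D" by blast
  then have D: "\<forall>x\<in>set xs. Poly_Mapping.keys x \<subseteq> degree_box D"
    unfolding degree_box_def M_def by blast
  define d where "d = CARD('n)"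
  define C where "C = D * length xs + 1"
  \<comment> \<open>With this choice N + 1 exceeds C ^ d, which gives the strict inequality below.\<close>
  define N where "N = C ^ d"
  define E where "E = {e. set e \<subseteq> {..N} \<and> length e = length xs}"
  define B where "B = (degree_box (D * N * length xs) :: ('n \<Rightarrow>\<^sub>0 nat) set)"
  have finE: "finite E" unfolding E_def by (intro finite_lists_length_eq) auto
  have "card B \<le> Suc (D * N * length xs) ^ d"
    unfolding B_def d_def by (rule card_degree_box)
  also have "\<dots> \<le> (C * Suc N) ^ d" unfolding C_def by (intro power_mono) (auto simp: algebra_simps)
  also have "\<dots> = N * Suc N ^ d" by (simp only: power_mult_distrib N_def)
  also have "\<dots> < Suc N ^ Suc d" by simp
  also have "\<dots> \<le> Suc N ^ length xs" using assms by (intro power_increasing) (auto simp: d_def)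
  also have "\<dots> = card E" unfolding E_def by (subst card_lists_length_eq) auto
  finally have "card B < card E" .
  then obtain c where c: "\<exists>e\<in>E. c e \<noteq> 0"
    "\<forall>m\<in>B. (\<Sum>e\<in>E. c e * Poly_Mapping.lookup (monomial_value xs e) m) = 0"
    using homogeneous_system_solution[of B E "\<lambda>e. Poly_Mapping.lookup (monomial_value xs e)"]
      finE finite_degree_box B_def by auto
  have "(\<Sum>e\<in>E. c e * Poly_Mapping.lookup (monomial_value xs e) m) = 0" for m
  proof (cases "m \<in> B")
    case False
    have "Poly_Mapping.lookup (monomial_value xs e) m = 0" if "e \<in> E" for e
    proof -
      have "Poly_Mapping.keys (monomial_value xs e) \<subseteq> B"
        unfolding B_def using that D by (intro keys_monomial_value) (auto simp: E_def)
      with False show ?thesis by (auto simp: in_keys_iff)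
    qed
    then show ?thesis by simp
  qed (use c in auto)
  then have "(\<Sum>e\<in>E. Poly_Mapping.single 0 (c e) * monomial_value xs e) = 0"
    by (intro poly_mapping_eqI) (simp add: lookup_sum lookup_const_mult)
  then show ?thesis using that finE c(1) E_def by blast
qed

text \<open>
  The proper prime ideals of a ring whose carrier is a whole type.
\<close>

definition prime_set :: "'a::comm_ring_1 set \<Rightarrow> bool" where
  "prime_set P \<longleftrightarrow> 0 \<in> P \<and> 1 \<notin> P \<and> (\<forall>a\<in>P. \<forall>b\<in>P. a + b \<in> P) \<and>
     (\<forall>a\<in>P. \<forall>b. b * a \<in> P) \<and> (\<forall>a b. a * b \<in> P \<longrightarrow> a \<in> P \<or> b \<in> P)"

lemma prime_setD:
  assumes "prime_set P"
  shows "0 \<in> P" "1 \<notin> P" "a \<in> P \<Longrightarrow> b \<in> P \<Longrightarrow> a + b \<in> P" "a \<in> P \<Longrightarrow> b * a \<in> P"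
    "a * b \<in> P \<Longrightarrow> a \<in> P \<or> b \<in> P"
  using assms by (auto simp: prime_set_def)

lemma prime_set_sum:
  assumes "prime_set P" "\<And>i. i \<in> I \<Longrightarrow> g i \<in> P"
  shows "sum g I \<in> P"
  using assms(2) by (induction I rule: infinite_finite_induct) (auto intro: prime_setD[OF assms(1)])

lemma prime_set_diff: "prime_set P \<Longrightarrow> a \<in> P \<Longrightarrow> b \<in> P \<Longrightarrow> a - b \<in> P"
  using prime_setD(3)[of P a "-1 * b"] prime_setD(4)[of P b "-1"] by simp

lemma prime_set_power: "prime_set P \<Longrightarrow> a ^ k \<in> P \<Longrightarrow> a \<in> P"
  by (induction k) (auto dest: prime_setD)

text \<open>
  Elements \<open>x\<^sub>j\<close> with \<open>x\<^sub>j \<in> P\<^sub>j\<^sub>+\<^sub>1 - P\<^sub>j\<close> along a chain of primes are algebraically independent, even modulo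
  \<open>P\<^sub>0\<close>. From a relation, factor out the lowest power of \<open>x\<^sub>0\<close> that occurs: as \<open>x\<^sub>0\<close> is not
  in the prime \<open>P\<^sub>0\<close>, the cofactor is in \<open>P\<^sub>0\<close>. Modulo \<open>P\<^sub>1\<close>, where \<open>x\<^sub>0\<close> vanishes, only its part without
  \<open>x\<^sub>0\<close> remains, a nontrivial relation between the later elements. In the end a nonzero
  constant would lie in a proper ideal.
\<close>

lemma prime_chain_no_relation:
  fixes xs :: "'n::finite rpoly list"
  assumes "\<And>j. j \<le> length xs \<Longrightarrow> prime_set (P j)"
    and "\<And>j. j < length xs \<Longrightarrow> P j \<subseteq> P (Suc j) \<and> xs ! j \<in> P (Suc j) - P j"
    and "finite E" "\<forall>e\<in>E. length e = length xs" "\<exists>e\<in>E. c e \<noteq> 0"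
  shows "(\<Sum>e\<in>E. Poly_Mapping.single 0 (c e) * monomial_value xs e) \<notin> P 0"
  using assms
proof (induction xs arbitrary: P E c)
  case Nil
  then have E: "E = {[]}" "c [] \<noteq> 0" by auto
  show ?case
  proof
    assume "(\<Sum>e\<in>E. Poly_Mapping.single 0 (c e) * monomial_value [] e) \<in> P 0"
    then have "Poly_Mapping.single 0 (c []) \<in> P 0" using E by simp
    then have "Poly_Mapping.single 0 (1 / c []) * Poly_Mapping.single 0 (c []) \<in> P 0"
      using prime_setD(4)[of "P 0"] Nil.prems(1)[of 0] by simp
    then show False using prime_setD(2)[of "P 0"] Nil.prems(1)[of 0] E by (simp add: mult_single)
  qed
next
  case (Cons x xs)
  have prime0: "prime_set (P 0)" and prime1: "prime_set (P 1)"
    using Cons.prems(1)[of 0] Cons.prems(1)[of 1] by auto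
  have x: "P 0 \<subseteq> P 1" "x \<in> P 1" "x \<notin> P 0" using Cons.prems(2)[of 0] by auto
  define E0 where "E0 = {e \<in> E. c e \<noteq> 0}"
  define k where "k = Min (hd ` E0)"
  define F where "F = {e \<in> E0. hd e = k}"
  have E0: "finite E0" "E0 \<noteq> {}" using Cons.prems by (auto simp: E0_def)
  then have "k \<in> hd ` E0" unfolding k_def by (intro Min_in) auto
  have kle: "k \<le> hd e" if "e \<in> E0" for e using that E0 unfolding k_def by auto
  have cons: "e = hd e # tl e" if "e \<in> E0" for e
    using that Cons.prems(4) by (cases e) (auto simp: E0_def)
  let ?t = "\<lambda>e. Poly_Mapping.single 0 (c e) * monomial_value xs (tl e)"
  have factor_x: "Poly_Mapping.single 0 (c e) * monomial_value (x # xs) e = x ^ k * (x ^ (hd e - k) * ?t e)"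
    if "e \<in> E0" for e
  proof -
    have "monomial_value (x # xs) e = x ^ hd e * monomial_value xs (tl e)"
      by (subst cons[OF that]) simp
    also have "x ^ hd e = x ^ k * x ^ (hd e - k)" using kle[OF that] by (simp add: power_add[symmetric])
    finally show ?thesis by (simp only: ac_simps)
  qed
  show ?case
  proof
    assume "(\<Sum>e\<in>E. Poly_Mapping.single 0 (c e) * monomial_value (x # xs) e) \<in> P 0"
    also have "(\<Sum>e\<in>E. Poly_Mapping.single 0 (c e) * monomial_value (x # xs) e) =
      (\<Sum>e\<in>E0. Poly_Mapping.single 0 (c e) * monomial_value (x # xs) e)"
      using Cons.prems(3) by (intro sum.mono_neutral_right) (auto simp: E0_def)
    also have "\<dots> = x ^ k * (\<Sum>e\<in>E0. x ^ (hd e - k) * ?t e)"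
      by (simp add: sum_distrib_left factor_x)
    finally have "(\<Sum>e\<in>E0. x ^ (hd e - k) * ?t e) \<in> P 0"
      using prime_setD(5)[OF prime0] prime_set_power[OF prime0] x(3) by blast
    then have all: "(\<Sum>e\<in>E0. x ^ (hd e - k) * ?t e) \<in> P 1" using x by blast
    have "x ^ (hd e - k) * ?t e \<in> P 1" if "e \<in> E0 - F" for e
    proof -
      have "k < hd e" using that kle[of e] by (auto simp: F_def)
      then obtain n where "hd e - k = Suc n" by (cases "hd e - k") auto
      then have "x ^ (hd e - k) * ?t e = (x ^ n * ?t e) * x" by (simp add: ac_simps)
      then show ?thesis using prime_setD(4)[OF prime1 x(2)] by metis
    qed
    then have rest: "(\<Sum>e\<in>E0 - F. x ^ (hd e - k) * ?t e) \<in> P 1" by (rule prime_set_sum[OF prime1])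
    have lowest: "(\<Sum>e\<in>F. ?t e) =
      (\<Sum>e\<in>E0. x ^ (hd e - k) * ?t e) - (\<Sum>e\<in>E0 - F. x ^ (hd e - k) * ?t e)"
    proof -
      have "(\<Sum>e\<in>E0. x ^ (hd e - k) * ?t e) =
        (\<Sum>e\<in>E0 - F. x ^ (hd e - k) * ?t e) + (\<Sum>e\<in>F. x ^ (hd e - k) * ?t e)"
        using E0 by (intro sum.subset_diff) (auto simp: F_def)
      moreover have "(\<Sum>e\<in>F. x ^ (hd e - k) * ?t e) = (\<Sum>e\<in>F. ?t e)"
        by (intro sum.cong) (auto simp: F_def)
      ultimately show ?thesis by simp
    qed
    have "(\<Sum>e\<in>F. ?t e) \<in> P 1"
      unfolding lowest using all rest by (rule prime_set_diff[OF prime1])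
    moreover have "(\<Sum>e\<in>F. ?t e) = (\<Sum>e\<in>tl ` F. Poly_Mapping.single 0 (c (k # e)) * monomial_value xs e)"
    proof -
      have hdF: "k # tl e = e" if "e \<in> F" for e using that cons[of e] by (auto simp: F_def)
      have "inj_on tl F"
      proof (rule inj_onI)
        fix e e' assume "e \<in> F" "e' \<in> F" "tl e = tl e'"
        then show "e = e'" using hdF by metis
      qed
      then have "(\<Sum>e\<in>tl ` F. Poly_Mapping.single 0 (c (k # e)) * monomial_value xs e) =
        (\<Sum>e\<in>F. Poly_Mapping.single 0 (c (k # tl e)) * monomial_value xs (tl e))"
        by (simp add: sum.reindex)
      also have "\<dots> = (\<Sum>e\<in>F. ?t e)"
        by (rule sum.cong[OF refl]) (simp only: hdF)
      finally show ?thesis by (rule sym)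
    qed
    ultimately have mem: "(\<Sum>e\<in>tl ` F. Poly_Mapping.single 0 (c (k # e)) * monomial_value xs e) \<in> P (Suc 0)"
      by simp
    have "(\<Sum>e\<in>tl ` F. Poly_Mapping.single 0 (c (k # e)) * monomial_value xs e) \<notin> P (Suc 0)"
    proof (rule Cons.IH)
      show "prime_set (P (Suc j))" if "j \<le> length xs" for j using that Cons.prems(1) by simp
      show "P (Suc j) \<subseteq> P (Suc (Suc j)) \<and> xs ! j \<in> P (Suc (Suc j)) - P (Suc j)" if "j < length xs" for j
        using that Cons.prems(2)[of "Suc j"] by simp
      show "finite (tl ` F)" using E0 by (simp add: F_def)
      show "\<forall>e\<in>tl ` F. length e = length xs" using Cons.prems(4) by (auto simp: F_def E0_def)
      obtain e where "e \<in> F" using \<open>k \<in> hd ` E0\<close> by (auto simp: F_def)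
      then show "\<exists>e\<in>tl ` F. c (k # e) \<noteq> 0"
        using cons[of e] by (intro bexI[of _ "tl e"]) (auto simp: F_def E0_def)
    qed
    with mem show False by blast
  qed
qed

text \<open>
  This bounds the Krull dimension of the polynomial ring: elements chosen from the successive
  differences of a longer chain would be dependent by their number, and independent by the preceding lemma.
\<close>

theorem prime_chain_length:
  fixes P :: "nat \<Rightarrow> 'n::finite rpoly set"
  assumes "\<And>j. j \<le> n \<Longrightarrow> prime_set (P j)" "\<And>j. j < n \<Longrightarrow> P j \<subset> P (Suc j)"
  shows "n \<le> CARD('n)"
proof (rule ccontr)
  assume n: "\<not> n \<le> CARD('n)"
  define xs where "xs = map (\<lambda>j. SOME x. x \<in> P (Suc j) - P j) [0..<n]"
  have len: "length xs = n" by (simp add: xs_def)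
  have xs: "P j \<subseteq> P (Suc j) \<and> xs ! j \<in> P (Suc j) - P j" if "j < n" for j
  proof -
    have "\<exists>x. x \<in> P (Suc j) - P j" using assms(2)[OF that] by blast
    from someI_ex[OF this] show ?thesis using assms(2)[OF that] that by (auto simp: xs_def)
  qed
  obtain E c where "finite E" "\<forall>e\<in>E. length e = length xs" "\<exists>e\<in>E. c e \<noteq> 0"
    "(\<Sum>e\<in>E. Poly_Mapping.single 0 (c e) * monomial_value xs e) = 0"
    using algebraic_dependence[of xs] n len by auto
  then show False
    using prime_chain_no_relation[of xs P E c] assms(1) xs len prime_setD(1)[OF assms(1)[of 0]] by auto
qed

section \<open>Vanishing ideals of codimension one\<close>

definition Rn :: "'n::finite rpoly ring" where "Rn = ring_of_type_algebra"

lemma Rn_simps [simp]: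
  "carrier Rn = UNIV" "x \<otimes>\<^bsub>Rn\<^esub> y = x * y" "\<one>\<^bsub>Rn\<^esub> = 1" "\<zero>\<^bsub>Rn\<^esub> = 0" "x \<oplus>\<^bsub>Rn\<^esub> y = x + y"
  by (simp_all add: Rn_def ring_of_type_algebra_def)

lemma cring_Rn: "cring Rn"
  unfolding Rn_def by (rule cring_from_type_algebra)

lemma prime_set_of_primeideal:
  assumes "primeideal P Rn"
  shows "prime_set P"
proof -
  interpret primeideal P Rn by fact
  have "1 \<notin> P" using one_imp_carrier I_notcarr by auto
  then show ?thesis unfolding prime_set_def
    using additive_subgroup.zero_closed[OF additive_subgroup_axioms, simplified]
      additive_subgroup.a_closed[OF additive_subgroup_axioms, simplified]
      I_l_closed[simplified] I_prime[simplified] by auto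
qed

lemma ideal_vanishing: "ideal (vanishing_ideal S) Rn"
proof (rule idealI)
  show "ring Rn" using cring_Rn by (rule cring.axioms)
  then interpret ring Rn .
  have inv: "\<ominus>\<^bsub>Rn\<^esub> a = - a" for a by (rule minus_equality) auto
  have ev: "rpoly_eval (- a) x = - rpoly_eval a x" for a :: "'a rpoly" and x
    using eval_add[of a "- a" x] by simp
  show "subgroup (vanishing_ideal S) (add_monoid Rn)"
    by (rule add.subgroupI) (auto simp: vanishing_ideal_def inv ev intro!: exI[of _ 0])
qed (auto simp: vanishing_ideal_def)

text \<open>
  A supremum of natural numbers that is at least \<open>k - 1\<close> has a member above \<open>k - 3/2\<close>, that is, a
  member that is at least \<open>k - 1\<close>. The chain of primes of the quotient ring that it belongs to is
  pulled back to the polynomial ring. The bound is written \<open>k \<le> n + 1\<close> to avoid truncated subtraction.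
\<close>

lemma prime_chain_of_semialg_dim:
  fixes S :: "(real ^ 'n::finite) set"
  assumes "ereal (real k - 1) \<le> semialg_dim S"
  obtains n Q where "k \<le> n + 1" "\<And>j. j \<le> n \<Longrightarrow> prime_set (Q j)"
    "\<And>j. j < n \<Longrightarrow> Q j \<subset> Q (Suc j)" "\<And>j. j \<le> n \<Longrightarrow> vanishing_ideal S \<subseteq> Q j"
proof -
  define I where "I = vanishing_ideal S"
  interpret I: ideal I Rn unfolding I_def by (rule ideal_vanishing)
  interpret h: ring_hom_ring Rn "Rn Quot I" "(+>\<^bsub>Rn\<^esub>) I" by (rule I.rcos_ring_hom_ring)
  define L where "L = {ereal (real n) | n. \<exists>P :: nat \<Rightarrow> 'n rpoly set set.
     (\<forall>i\<le>n. primeideal (P i) (Rn Quot I)) \<and> (\<forall>i<n. P i \<subset> P (Suc i))}"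
  have "ereal (real k - 3 / 2) < ereal (real k - 1)" by simp
  also have "\<dots> \<le> Sup L"
    using assms unfolding semialg_dim_def krull_dim_def L_def I_def Rn_def .
  finally obtain l where "l \<in> L" "ereal (real k - 3 / 2) < l" by (auto simp: less_Sup_iff)
  then obtain n P where l: "l = ereal (real n)" and P: "\<And>i. i \<le> n \<Longrightarrow> primeideal (P i) (Rn Quot I)"
    "\<And>i. i < n \<Longrightarrow> P i \<subset> P (Suc i)" unfolding L_def by blast
  have n: "real k - 3 / 2 < real n" using \<open>_ < l\<close> l by simp
  define Q where "Q j = {r. I +>\<^bsub>Rn\<^esub> r \<in> P j}" for j
  show ?thesis
  proof (rule that)
    have "real k < real (n + 2)" using n by simp
    then show "k \<le> n + 1" unfolding of_nat_less_iff by simp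
  next
    fix j assume j: "j \<le> n"
    have "primeideal {r \<in> carrier Rn. I +>\<^bsub>Rn\<^esub> r \<in> P j} Rn"
      by (rule h.primeideal_vimage[OF cring_Rn P(1)[OF j]])
    then show "prime_set (Q j)" unfolding Q_def by (intro prime_set_of_primeideal) simp
    interpret Pj: primeideal "P j" "Rn Quot I" by (rule P(1)[OF j])
    show "vanishing_ideal S \<subseteq> Q j"
    proof
      fix r assume "r \<in> vanishing_ideal S"
      then have "I +>\<^bsub>Rn\<^esub> r = I" using I.a_rcos_const by (simp add: I_def)
      moreover have "\<zero>\<^bsub>Rn Quot I\<^esub> = I" by (simp add: FactRing_def)
      moreover have "\<zero>\<^bsub>Rn Quot I\<^esub> \<in> P j" by (rule Pj.zero_closed)
      ultimately show "r \<in> Q j" by (simp add: Q_def)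
    qed
  next
    fix j assume j: "j < n"
    then obtain c where c: "c \<in> P (Suc j)" "c \<notin> P j" using P(2)[OF j] by blast
    interpret Pj: primeideal "P (Suc j)" "Rn Quot I" using P(1) j by simp
    have "c \<in> carrier (Rn Quot I)" using c(1) by (rule Pj.a_Hcarr)
    then obtain r where "c = I +>\<^bsub>Rn\<^esub> r" by (auto simp: FactRing_def A_RCOSETS_def')
    then have "r \<in> Q (Suc j)" "r \<notin> Q j" using c by (simp_all add: Q_def)
    moreover have "Q j \<subseteq> Q (Suc j)" using P(2)[OF j] by (auto simp: Q_def)
    ultimately show "Q j \<subset> Q (Suc j)" by blast
  qed
qed

text \<open>
  A chain of \<open>d\<close> primes, \<open>d\<close> being the number of variables, lies above the vanishing ideal. If the
  latter were larger than the prime ideal \<open>(f)\<close>, that chain could be extended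
  downwards by \<open>(f)\<close> and \<open>(0)\<close> to a chain of \<open>d + 2\<close> primes, too many for \<open>d\<close> variables.
\<close>

lemma vanishing_ideal_generated:
  fixes f :: "'n::finite rpoly"
  assumes f: "irreducible f" and S: "S \<subseteq> zero_set f"
    and dim: "semialg_dim S = ereal (real CARD('n) - 1)" and g: "g \<in> vanishing_ideal S"
  shows "f dvd g"
proof (rule ccontr)
  assume ndvd: "\<not> f dvd g"
  obtain n Q where n: "CARD('n) \<le> n + 1" and Q: "\<And>j. j \<le> n \<Longrightarrow> prime_set (Q j)"
    "\<And>j. j < n \<Longrightarrow> Q j \<subset> Q (Suc j)" "\<And>j. j \<le> n \<Longrightarrow> vanishing_ideal S \<subseteq> Q j"
    using prime_chain_of_semialg_dim[of "CARD('n)" S] dim by auto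
  define P where "P j = (case j of 0 \<Rightarrow> {0} | Suc 0 \<Rightarrow> {a. f dvd a} | Suc (Suc j) \<Rightarrow> Q j)" for j
  have "prime_set {0 :: 'n rpoly}" using rpoly_no_zero_div by (auto simp: prime_set_def)
  moreover have "prime_set {a. f dvd a}"
    using irreducible_dvd_mult[OF f] f by (auto simp: prime_set_def irreducible_def)
  moreover have fS: "f \<in> vanishing_ideal S" using S by (auto simp: vanishing_ideal_def zero_set_def)
  have "{a. f dvd a} \<subset> Q 0"
  proof
    show "{a. f dvd a} \<subseteq> Q 0"
    proof
      fix a assume "a \<in> {a. f dvd a}"
      then obtain b where "a = b * f" by (metis dvdE mem_Collect_eq mult.commute)
      then show "a \<in> Q 0" using prime_setD(4)[OF Q(1)[of 0]] fS Q(3)[of 0] by auto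
    qed
    show "{a. f dvd a} \<noteq> Q 0" using g ndvd Q(3)[of 0] by auto
  qed
  moreover have "{0} \<subset> {a. f dvd a}" using f by (auto simp: irreducible_def)
  ultimately have "prime_set (P j)" if "j \<le> n + 2" for j
    using that Q(1) by (auto simp: P_def split: nat.splits)
  moreover have "P j \<subset> P (Suc j)" if "j < n + 2" for j
  proof (cases j)
    case 0
    then show ?thesis using \<open>{0} \<subset> {a. f dvd a}\<close> by (simp add: P_def)
  next
    case (Suc i)
    then show ?thesis using \<open>{a. f dvd a} \<subset> Q 0\<close> that Q(2) by (cases i) (simp_all add: P_def)
  qed
  ultimately have "n + 2 \<le> CARD('n)" by (rule prime_chain_length)
  with n show False by linarith
qed

section \<open>Sign changes of an irreducible polynomial\<close>

lemma eval_poly: "rpoly_eval (poly F q) x = poly (map_poly (\<lambda>c. rpoly_eval c x) F) (rpoly_eval q x)"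
  by (induction F) (simp_all add: map_poly_pCons)

lemma eval_of_nat: "rpoly_eval (of_nat k) x = real k"
  by (induction k) simp_all

lemma eval_polys_in:
  fixes x y :: "real ^ 'n::finite"
  assumes "p \<in> polys_in V" "\<And>j. j \<in> V \<Longrightarrow> x $ j = y $ j"
  shows "rpoly_eval p x = rpoly_eval p y"
proof -
  have "(\<Prod>j\<in>UNIV. (x $ j) ^ Poly_Mapping.lookup m j) = (\<Prod>j\<in>UNIV. (y $ j) ^ Poly_Mapping.lookup m j)"
    if "m \<in> Poly_Mapping.keys p" for m
  proof (intro prod.cong refl)
    fix j
    have "Poly_Mapping.lookup m j = 0" if "j \<notin> V"
      using assms(1) \<open>m \<in> Poly_Mapping.keys p\<close> that unfolding polys_in_def
      by (metis (mono_tags, lifting) in_keys_iff mem_Collect_eq subsetD)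
    then show "(x $ j) ^ Poly_Mapping.lookup m j = (y $ j) ^ Poly_Mapping.lookup m j"
      using assms(2)[of j] by (cases "j \<in> V") auto
  qed
  then show ?thesis unfolding rpoly_eval_def by (intro sum.cong) auto
qed

text \<open>
  For \<open>g\<close> take the formal derivative with respect to a variable that occurs in \<open>f\<close>. It is nonzero
  because the characteristic is zero, and not divisible by \<open>f\<close> because its degree in that variable is smaller.
\<close>

lemma partial_derivative:
  fixes f :: "'n::finite rpoly"
  assumes "f \<noteq> 0" "\<not> f dvd 1"
  obtains g i where "\<not> f dvd g"
    "\<And>x. ((\<lambda>t. rpoly_eval f (x + t *\<^sub>R axis i 1)) has_real_derivative rpoly_eval g x) (at 0)"
proof -
  \<comment> \<open>Otherwise f involves no variable at all and is a unit.\<close>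
  have "\<exists>i. f \<notin> polys_in (UNIV - {i})"
  proof (rule ccontr)
    assume "\<not> ?thesis"
    then have "f \<in> polys_in {}" unfolding polys_in_def by blast
    then obtain c where c: "f = Poly_Mapping.single 0 c" by (auto simp: polys_in_empty)
    moreover from this assms have "c \<noteq> 0" by auto
    ultimately have "1 = f * Poly_Mapping.single 0 (1 / c)" by (simp add: mult_single)
    then show False using assms dvdI by blast
  qed
  then obtain i where i: "f \<notin> polys_in (UNIV - {i})" by blast
  obtain N where N: "factorial_subring (polys_in (UNIV - {i})) N" using factorial_polys_in by blast
  then interpret R: factorial_subring "polys_in (UNIV - {i})" N .
  have "(\<lambda>F. poly F (rvar i)) ` R.polys = UNIV"
    using polys_in_insert[OF N, of i] by (simp add: polys_in_UNIV insert_absorb)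
  then have surj: "\<exists>F\<in>R.polys. g = poly F (rvar i)" for g by blast
  obtain F where F: "F \<in> R.polys" "f = poly F (rvar i)" using surj by blast
  have coeff: "\<And>G k. G \<in> R.polys \<Longrightarrow> coeff G k \<in> polys_in (UNIV - {i})" by (auto simp: R.polys_def)
  have "degree F \<noteq> 0"
  proof
    assume "degree F = 0"
    then have "f = coeff F 0" using F(2) by (metis degree_eq_zeroE poly_const_conv coeff_pCons_0)
    then show False using i coeff[OF F(1)] by metis
  qed
  \<comment> \<open>The formal derivative of F, written out coefficientwise because pderiv is restricted
    to coefficient types without zero divisors.\<close>
  define F' where "F' = (\<Sum>k\<le>degree F. monom (of_nat (Suc k) * coeff F (Suc k)) k)"
  have coeff_F': "coeff F' k = of_nat (Suc k) * coeff F (Suc k)" for k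
    by (auto simp: F'_def coeff_sum coeff_eq_0 not_le simp del: of_nat_Suc)
  have pF: "F' \<in> R.polys"
  proof -
    have scale: "of_nat k * a \<in> polys_in (UNIV - {i})" if "a \<in> polys_in (UNIV - {i})" for k a
      using that by (induction k) (auto simp: distrib_right intro: R.add_closed R.zero_closed)
    have "coeff F' k \<in> polys_in (UNIV - {i})" for k
      unfolding coeff_F' by (rule scale[OF coeff[OF F(1)]])
    then show ?thesis by (simp add: R.polys_def)
  qed
  show ?thesis
  proof (rule that)
    show "\<not> f dvd poly (F') (rvar i)"
    proof
      assume "f dvd poly (F') (rvar i)"
      then obtain h where "poly (F') (rvar i) = f * h" by (rule dvdE)
      moreover obtain H where H: "H \<in> R.polys" "h = poly H (rvar i)" using surj by blast
      ultimately have eq: "poly (F') (rvar i) = poly (F * H) (rvar i)" using F by simp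
      have FH: "F' = F * H"
        by (rule poly_rvar_inj[OF coeff[OF pF] coeff[OF R.polys_mult[OF F(1) H(1)]] _ eq]) simp
      have "F \<noteq> 0" using assms F by auto
      have "coeff (F') (degree F - 1) \<noteq> 0"
      proof
        assume "coeff (F') (degree F - 1) = 0"
        then have "of_nat (degree F) * lead_coeff F = 0"
          using \<open>degree F \<noteq> 0\<close> by (simp add: coeff_F' del: of_nat_Suc)
        then have "real (degree F) * Poly_Mapping.lookup (lead_coeff F) m = 0" for m
          using lookup_const_mult[of "real (degree F)" "lead_coeff F" m]
          by (simp only: single_of_nat lookup_zero)
        then have "lead_coeff F = 0" using \<open>degree F \<noteq> 0\<close>
          by (metis lookup_zero mult_eq_0_iff of_nat_eq_0_iff poly_mapping_eqI)
        then show False using \<open>F \<noteq> 0\<close> by simp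
      qed
      then have "H \<noteq> 0" using FH by auto
      note FH_props = F(1) H(1) \<open>F \<noteq> 0\<close> this
      have "coeff (F * H) (degree F + degree H) \<noteq> 0"
        using R.polys_mult_nonzero[OF FH_props] R.polys_degree_mult[OF FH_props]
        by (metis leading_coeff_0_iff)
      moreover have "coeff (F') (degree F + degree H) = 0"
        by (simp add: coeff_F' coeff_eq_0)
      ultimately show False using FH by simp
    qed
    show "((\<lambda>t. rpoly_eval f (x + t *\<^sub>R axis i 1)) has_real_derivative
      rpoly_eval (poly (F') (rvar i)) x) (at 0)" for x
    proof -
      let ?G = "map_poly (\<lambda>c. rpoly_eval c x) F"
      have "rpoly_eval f (x + t *\<^sub>R axis i 1) = poly ?G (x $ i + t)" for t
      proof -
        let ?y = "x + t *\<^sub>R axis i 1"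
        have "map_poly (\<lambda>c. rpoly_eval c ?y) F = ?G"
          using eval_polys_in[OF coeff[OF F(1)], of ?y x]
          by (intro poly_eqI) (auto simp: coeff_map_poly axis_def)
        then show ?thesis unfolding F(2) eval_poly by (simp add: eval_rvar axis_def)
      qed
      moreover have "map_poly (\<lambda>c. rpoly_eval c x) (F') = pderiv ?G"
        by (intro poly_eqI) (simp add: coeff_map_poly coeff_pderiv coeff_F' eval_of_nat del: of_nat_Suc)
      then have "rpoly_eval (poly (F') (rvar i)) x = poly (pderiv ?G) (x $ i + 0) * (0 + 1)"
        unfolding eval_poly by (simp add: eval_rvar)
      moreover have "((\<lambda>t. poly ?G (x $ i + t)) has_real_derivative poly (pderiv ?G) (x $ i + 0) * (0 + 1)) (at 0)"
        by (rule DERIV_chain2[OF poly_DERIV]) (intro derivative_intros)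
      ultimately show ?thesis by simp
    qed
  qed
qed

text \<open>
  By primality, \<open>f\<close> does not divide the product of \<open>g\<close> and
  a partial derivative of \<open>f\<close>, so that this product is not in the vanishing ideal of \<open>S\<close>. Where
  it does not vanish on \<open>S\<close>, the polynomial \<open>f\<close> crosses zero with nonzero slope in a coordinate direction.
\<close>

lemma sign_change_point:
  fixes f :: "'n::finite rpoly"
  assumes f: "irreducible f" and S: "S \<subseteq> zero_set f"
    and dim: "semialg_dim S = ereal (real CARD('n) - 1)" and g: "\<not> f dvd g"
  obtains x where "x \<in> S" "rpoly_eval g x \<noteq> 0"
    "\<And>U. open U \<Longrightarrow> x \<in> U \<Longrightarrow> (\<exists>y\<in>U. 0 < rpoly_eval f y) \<and> (\<exists>y\<in>U. rpoly_eval f y < 0)"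
proof -
  obtain h i where h: "\<not> f dvd h" and
    deriv: "\<And>x. ((\<lambda>t. rpoly_eval f (x + t *\<^sub>R axis i 1)) has_real_derivative rpoly_eval h x) (at 0)"
    using partial_derivative[of f] f by (auto simp: irreducible_def)
  have "\<not> f dvd g * h" using irreducible_dvd_mult[OF f] g h by blast
  then have "g * h \<notin> vanishing_ideal S" using vanishing_ideal_generated[OF f S dim] by blast
  then obtain x where x: "x \<in> S" "rpoly_eval g x \<noteq> 0" "rpoly_eval h x \<noteq> 0"
    by (auto simp: vanishing_ideal_def)
  have fx: "rpoly_eval f x = 0" using x(1) S by (auto simp: zero_set_def)
  let ?l = "\<lambda>t. x + t *\<^sub>R axis i (1::real)"
  show ?thesis
  proof (rule that[OF x(1,2)])
    fix U :: "(real ^ 'n) set" assume U: "open U" "x \<in> U"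
    have "open (?l -` U)" using U(1) by (intro open_vimage continuous_intros)
    moreover have "0 \<in> ?l -` U" using U(2) by simp
    ultimately obtain e where e0: "0 < e" "ball 0 e \<subseteq> ?l -` U" by (rule openE)
    then have e: "0 < e" "?l t \<in> U" if "\<bar>t\<bar> < e" for t using that by (auto simp: subset_iff)
    have "\<exists>s t. \<bar>s\<bar> < e \<and> \<bar>t\<bar> < e \<and> 0 < rpoly_eval f (?l s) \<and> rpoly_eval f (?l t) < 0"
    proof (cases "0 < rpoly_eval h x")
      case True
      obtain d1 where d1: "0 < d1" "\<forall>u>0. u < d1 \<longrightarrow> rpoly_eval f (?l 0) < rpoly_eval f (?l (0 + u))"
        using DERIV_pos_inc_right[OF deriv True] by blast
      obtain d2 where d2: "0 < d2" "\<forall>u>0. u < d2 \<longrightarrow> rpoly_eval f (?l (0 - u)) < rpoly_eval f (?l 0)"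
        using DERIV_pos_inc_left[OF deriv True] by blast
      define u where "u = Min {d1, d2, e} / 2"
      have "0 < u" "u < d1" "u < d2" "u < e" using d1(1) d2(1) e0(1) by (auto simp: u_def)
      then show ?thesis using d1(2) d2(2) fx
        by (intro exI[of _ u] exI[of _ "- u"]) (auto dest!: spec[of _ u])
    next
      case False
      then have neg: "rpoly_eval h x < 0" using x(3) by simp
      obtain d1 where d1: "0 < d1" "\<forall>u>0. u < d1 \<longrightarrow> rpoly_eval f (?l (0 + u)) < rpoly_eval f (?l 0)"
        using DERIV_neg_dec_right[OF deriv neg] by blast
      obtain d2 where d2: "0 < d2" "\<forall>u>0. u < d2 \<longrightarrow> rpoly_eval f (?l 0) < rpoly_eval f (?l (0 - u))"
        using DERIV_neg_dec_left[OF deriv neg] by blast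
      define u where "u = Min {d1, d2, e} / 2"
      have "0 < u" "u < d1" "u < d2" "u < e" using d1(1) d2(1) e0(1) by (auto simp: u_def)
      then show ?thesis using d1(2) d2(2) fx
        by (intro exI[of _ "- u"] exI[of _ u]) (auto dest!: spec[of _ u])
    qed
    then show "(\<exists>y\<in>U. 0 < rpoly_eval f y) \<and> (\<exists>y\<in>U. rpoly_eval f y < 0)"
      using e(2) by blast
  qed
qed

section \<open>Factors of the defining inequalities\<close>

text \<open>
  For the first claim, \<open>g\<close> in the preceding lemma is the product of all \<open>p i\<close>: where it is nonzero on
  \<open>A\<close>, all \<open>p i\<close> are positive, so \<open>A\<close> contains a neighbourhood, on which \<open>f\<close> would have to vanish. For the
  second claim, \<open>g\<close> is the cofactor of the highest power of \<open>f\<close> in \<open>p i\<close>.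
\<close>

theorem corollary1p3:
  fixes p :: "nat \<Rightarrow> ('n::finite) rpoly"
    and m :: nat
    and f :: "'n rpoly"
    and A :: "(real ^ 'n) set"
    and b :: "real ^ 'n"
    and \<epsilon> :: real
  assumes p_nonzero: "\<And>i. i \<in> {1..m} \<Longrightarrow> p i \<noteq> 0"
    and A_def: "A = nonneg_set m p"
    and f_irreducible: "irreducible f"
    and b_in: "b \<in> zero_set f"
    and eps_pos: "\<epsilon> > 0"
    and dim_local: "semialg_dim (zero_set f \<inter> ball b \<epsilon>) = ereal (real CARD('n) - 1)"
    and local_eq: "zero_set f \<inter> ball b \<epsilon> = A \<inter> ball b \<epsilon>"
    and dim_interior: "semialg_dim (interior A \<inter> zero_set f) = ereal (real CARD('n) - 1)"
  shows "(\<exists>i\<in>{1..m}. f dvd p i) \<and>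
         (\<forall>i\<in>{1..m}. f dvd p i \<longrightarrow> (\<exists>k. has_multiplicity f k (p i) \<and> even k))"
proof (intro conjI ballI impI)
  show "\<exists>i\<in>{1..m}. f dvd p i"
  proof (rule ccontr)
    assume none: "\<not> ?thesis"
    have ndvd: "\<not> f dvd (\<Prod>i\<in>I. p i)" if "finite I" "I \<subseteq> {1..m}" for I
      using that
    proof (induction I)
      case empty
      then show ?case using f_irreducible by (auto simp: irreducible_def)
    next
      case (insert i I)
      then have "\<not> f dvd p i" "\<not> f dvd (\<Prod>i\<in>I. p i)" using none by auto
      then show ?case
        using irreducible_dvd_mult[OF f_irreducible, of "p i" "\<Prod>i\<in>I. p i"] insert.hyps by auto
    qed
    obtain x where x: "x \<in> zero_set f \<inter> ball b \<epsilon>" "rpoly_eval (\<Prod>i\<in>{1..m}. p i) x \<noteq> 0"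
      and change: "\<And>U. open U \<Longrightarrow> x \<in> U \<Longrightarrow>
        (\<exists>y\<in>U. 0 < rpoly_eval f y) \<and> (\<exists>y\<in>U. rpoly_eval f y < 0)"
      using sign_change_point[OF f_irreducible Int_lower1 dim_local ndvd[of "{1..m}"]] by auto
    \<comment> \<open>On U all p i are positive, so U lies in A, hence in the zero set of f.\<close>
    define U where "U = ball b \<epsilon> \<inter> (\<Inter>i\<in>{1..m}. {y. 0 < rpoly_eval (p i) y})"
    have "open U" unfolding U_def
      by (intro open_Int open_ball open_INT open_Collect_less continuous_eval continuous_on_const finite_atLeastAtMost ballI)
    moreover have "x \<in> U"
    proof -
      have "0 < rpoly_eval (p i) x" if "i \<in> {1..m}" for i
      proof -
        have "x \<in> A" using x(1) local_eq by blast
        then have "0 \<le> rpoly_eval (p i) x" using that by (auto simp: A_def nonneg_set_def)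
        moreover have "rpoly_eval (p i) x \<noteq> 0" using x(2) that by (simp add: eval_prod)
        ultimately show ?thesis by simp
      qed
      then show ?thesis using x(1) by (auto simp: U_def)
    qed
    ultimately obtain y where y: "y \<in> U" "0 < rpoly_eval f y" using change by blast
    then have "y \<in> A \<inter> ball b \<epsilon>" by (auto simp: U_def A_def nonneg_set_def intro: less_imp_le)
    then have "y \<in> zero_set f" using local_eq by blast
    then show False using y(2) by (simp add: zero_set_def)
  qed
next
  fix i assume i: "i \<in> {1..m}" and "f dvd p i"
  obtain k where k: "f ^ k dvd p i" "\<not> f ^ Suc k dvd p i"
    using finite_multiplicity[OF f_irreducible p_nonzero[OF i]] by blast
  have "k \<noteq> 0" using k(2) \<open>f dvd p i\<close> by (cases k) auto
  then have mult: "has_multiplicity f k (p i)" using k by (simp add: has_multiplicity_def)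
  have "even k"
  proof (rule ccontr)
    assume "odd k"
    obtain q where q: "p i = f ^ k * q" using k(1) by (rule dvdE)
    have "\<not> f dvd q"
    proof
      assume "f dvd q"
      then obtain r where "q = f * r" by (rule dvdE)
      then have "p i = f ^ Suc k * r" using q by (simp add: ac_simps)
      then show False using k(2) by (metis dvdI)
    qed
    then obtain x where x: "x \<in> interior A \<inter> zero_set f" "rpoly_eval q x \<noteq> 0"
      and change: "\<And>U. open U \<Longrightarrow> x \<in> U \<Longrightarrow>
        (\<exists>y\<in>U. 0 < rpoly_eval f y) \<and> (\<exists>y\<in>U. rpoly_eval f y < 0)"
      using sign_change_point[OF f_irreducible Int_lower2 dim_interior] by metis
    \<comment> \<open>Near x the sign of q is constant while the odd power of f changes sign.\<close>
    have nonneg: "0 \<le> rpoly_eval f y ^ k * rpoly_eval q y" if "y \<in> interior A" for y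
    proof -
      have "y \<in> A" using that interior_subset by blast
      then have "0 \<le> rpoly_eval (p i) y" using i by (auto simp: A_def nonneg_set_def)
      then show ?thesis by (simp add: q)
    qed
    show False
    proof (cases "0 < rpoly_eval q x")
      case True
      define U where "U = interior A \<inter> {y. 0 < rpoly_eval q y}"
      have "open U" unfolding U_def
        by (intro open_Int open_interior open_Collect_less continuous_eval continuous_on_const)
      moreover have "x \<in> U" using x True by (simp add: U_def)
      ultimately obtain y where "y \<in> U" "rpoly_eval f y < 0" using change by blast
      then show False using nonneg[of y] \<open>odd k\<close>
        by (auto simp: U_def zero_le_mult_iff power_less_zero_eq zero_le_power_eq)
    next
      case False
      define U where "U = interior A \<inter> {y. rpoly_eval q y < 0}"
      have "open U" unfolding U_def
        by (intro open_Int open_interior open_Collect_less continuous_eval continuous_on_const)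
      moreover have "x \<in> U" using x False by (simp add: U_def)
      ultimately obtain y where "y \<in> U" "0 < rpoly_eval f y" using change by blast
      then show False using nonneg[of y] by (auto simp: U_def zero_le_mult_iff power_le_zero_eq)
    qed
  qed
  with mult show "\<exists>k. has_multiplicity f k (p i) \<and> even k" by blast
qed

end
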